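(* For every $\theta\in\mathbb R$, \[\limsup_{n\to\infty}\sqrt{\frac{n}{\log\log n}}\,(\hat\theta_n-\theta)=\sqrt{\frac{2(m+1)}{m(2m-1)}}\quad P\text{-a.s.}\]
   Context: Fix $m>1/2$. Let $c_m:=\left(\int_{\mathbb R}(1+x^2)^{-m}\,dx\right)^{-1}$ and $f(x):=c_m(1+x^2)^{-m}$. For $\theta\in\mathbb R$, $\mathrm{PVII}_m(\theta,1)$ denotes the Pearson Type VII distribution with location $\theta$ and scale $1$, i.e. the law with density $x\mapsto f(x-\theta)$. Let $(X_n)_{n\ge1}$ be i.i.d. random variables on a probability space $(\Omega,\mathcal F,P)$ with law $\mathrm{PVII}_m(\theta,1)$. For each $n$, let $\hat\theta_n(x_1,\dots,x_n)$ be any Borel measurable function on $\mathbb R^n$ such that $\hat\theta_n(x_1,\dots,x_n)$ is a maximizer of $t\mapsto\prod_{i=1}^n f(x_i-t)$ over $t\in\mathbb R$, and let $\hat\theta_n:=\hat\theta_n(X_1,\dots,X_n)$ (the maximum likelihood estimator). *)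

theory Defs
  imports "HOL-Probability.Probability"
begin

definition pvii_const :: "real \<Rightarrow> real" where
  "pvii_const m = inverse (integral\<^sup>L lborel (\<lambda>x::real. (1 + x\<^sup>2) powr (- m)))"

definition pvii_density :: "real \<Rightarrow> real \<Rightarrow> real" where
  "pvii_density m x = pvii_const m * (1 + x\<^sup>2) powr (- m)"

definition pvii_lik :: "real \<Rightarrow> nat \<Rightarrow> (nat \<Rightarrow> real) \<Rightarrow> real \<Rightarrow> real" where
  "pvii_lik m n x t = (\<Prod>i<n. pvii_density m (x i - t))"

end

theory Submission
  imports Defs "HOL-Real_Asymp.Real_Asymp"
begin

text \<open>
  With \<open>z = x - \<theta>\<close> the maximum likelihood estimator minimises \<open>\<Sum>i. ln (1 + (z\<^sub>i - d)\<^sup>2)\<close> in the error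
  \<open>d\<close>, so \<open>\<Sum>i. \<psi> (z\<^sub>i - d) = 0\<close> for the score \<open>\<psi> u = 2 u / (1 + u\<^sup>2)\<close>. Once \<open>d\<close> tends to zero,
  linearising gives \<open>d = (\<Sum>i. \<psi> z\<^sub>i) / (n J\<^sub>n)\<close> with \<open>J\<^sub>n\<close> tending to
  \<open>E \<psi>' = (2 m - 1) / (m + 1)\<close>, and the claim is the law of the iterated logarithm for the bounded
  scores, whose variance is \<open>(2 m - 1) / (m (m + 1))\<close>.

  Consistency needs only strong laws for bounded variables, because the contrasts
  \<open>ln (1 + (z - t)\<^sup>2) - ln (1 + z\<^sup>2)\<close> are 1-Lipschitz in \<open>t\<close> and have positive mean for \<open>t \<noteq> 0\<close>
  (Gibbs' inequality); far away from zero they are bounded below by means of the empirical mass of one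
  large interval.

  In the law of the iterated logarithm the upper bound uses an exponential maximal inequality along
  \<open>\<lambda>\<^sup>k\<close>. The lower bound needs no change of measure: a moderate deviation of \<open>S\<^sub>n\<close> is
  forced by having every one of a slowly growing number of blocks exceed a fixed Gaussian level, whose
  probability the central limit theorem provides.
\<close>

section \<open>Law of the iterated logarithm for bounded variables\<close>

text \<open>The negative log-likelihood is not convex, and the likelihood equation may have several
  roots, some far from \<open>\<theta>\<close>. Consistency therefore has to come from global
  minimality; stationarity is exploited only through the linearisation around zero. The observations
  need not have a mean (for m \<le> 1 they have none), but everything that is averaged is bounded:
  indicators of an interval, contrasts at a fixed point, the score and its derivative. The iterated
  logarithm must be sharp in the variance and not only in the range of the variables. Hence the
  upper half uses a moment generating function bound asymptotic to the Gaussian one, and the lower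
  half the exact Gaussian tail at a level chosen large enough. Origin of the constant: the
  log-likelihood carries a factor m, so E \<psi>' = m E \<psi>^2 and the Fisher information is I = m
  E \<psi>' = m (2 m - 1) / (m + 1). The ratio of \<open>sqrt 2 * \<sigma>\<close> to E \<psi>' is
  then \<open>sqrt (2 / I)\<close>.\<close>

lemma exp_le_quadratic: "exp (y::real) \<le> 1 + y + y\<^sup>2 / 2 * exp \<bar>y\<bar>"
proof -
  obtain t where t: "\<bar>t\<bar> \<le> \<bar>y\<bar>" "exp y = (\<Sum>m<2. y ^ m / fact m) + exp t / fact 2 * y ^ 2"
    using Maclaurin_exp_le by blast
  have "exp t \<le> exp \<bar>y\<bar>" using t(1) by simp
  then have "exp t * y\<^sup>2 \<le> exp \<bar>y\<bar> * y\<^sup>2" by (intro mult_right_mono) auto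
  then show ?thesis using t(2) by (simp add: numeral_2_eq_2 field_simps)
qed

text \<open>By independence and 1 - p \<le> exp (- p), avoiding all events from N on has probability
  at most exp of minus every partial sum; were this probability positive, its logarithm would bound
  those sums.\<close>

lemma (in prob_space) borel_cantelli2:
  assumes indep: "indep_events A (UNIV :: nat set)"
    and div: "\<not> summable (\<lambda>n. prob (A n))"
  shows "AE x in M. \<exists>\<^sub>F n in sequentially. x \<in> A n"
proof -
  have A [measurable]: "A n \<in> events" for n
    using indep unfolding indep_events_def by auto
  have null: "prob (\<Inter>n\<in>{N..}. space M - A n) = 0" for N
  proof -
    define p where "p n = prob (A n)" for n
    have le: "prob (\<Inter>n\<in>{N..}. space M - A n) \<le> exp (- (\<Sum>i<k. p (i + N)))" for k
    proof (cases "k = 0")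
      case True then show ?thesis by simp
    next
      case False
      have ic: "indep_events (\<lambda>n. space M - A n) UNIV"
      proof -
        have "indep_sets (\<lambda>i. sigma_sets (space M) {A i}) UNIV"
        proof (rule indep_sets_sigma)
          show "indep_sets (\<lambda>i. {A i}) UNIV"
            using indep unfolding indep_events_def_alt .
        qed (simp add: Int_stable_def)
        then show ?thesis
          unfolding indep_events_def_alt
          by (rule indep_sets_mono_sets) (auto intro: sigma_sets.intros)
      qed
      have "prob (\<Inter>n\<in>{N..}. space M - A n) \<le> prob (\<Inter>n\<in>{N..<N+k}. space M - A n)"
        using False by (intro finite_measure_mono) auto
      also have "\<dots> = (\<Prod>n\<in>{N..<N+k}. prob (space M - A n))"
        using ic False unfolding indep_events_def by auto
      also have "\<dots> = (\<Prod>n\<in>{N..<N+k}. 1 - p n)"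
        by (simp add: prob_compl p_def)
      also have "\<dots> \<le> (\<Prod>n\<in>{N..<N+k}. exp (- p n))"
        by (intro prod_mono) (use exp_ge_add_one_self[of "- p _"] in \<open>auto simp: p_def\<close>)
      also have "\<dots> = exp (- (\<Sum>n\<in>{N..<N+k}. p n))"
        by (simp add: exp_sum sum_negf[symmetric])
      also have "(\<Sum>n\<in>{N..<N+k}. p n) = (\<Sum>i<k. p (i + N))"
        by (rule sum.reindex_bij_witness[of _ "\<lambda>i. i + N" "\<lambda>n. n - N"]) auto
      finally show ?thesis .
    qed
    have nonneg: "0 \<le> p (i + N)" for i by (simp add: p_def)
    have not_summable: "\<not> summable (\<lambda>i. p (i + N))"
      using div summable_iff_shift[of "\<lambda>n. prob (A n)" N] by (simp add: p_def)
    show ?thesis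
    proof (rule ccontr)
      assume "prob (\<Inter>n\<in>{N..}. space M - A n) \<noteq> 0"
      then have pos: "prob (\<Inter>n\<in>{N..}. space M - A n) > 0" (is "?P > 0")
        by (simp add: zero_less_measure_iff)
      have "(\<Sum>i<k. p (i + N)) \<le> - ln ?P" for k
        using ln_mono[OF le[of k] pos] by simp
      then have "summable (\<lambda>i. p (i + N))"
        by (intro summableI_nonneg_bounded[where x="- ln ?P"] nonneg)
      with not_summable show False by simp
    qed
  qed
  have "AE x in M. x \<notin> (\<Inter>n\<in>{N..}. space M - A n)" for N
    by (rule AE_not_in) (use null in \<open>auto simp: null_sets_def emeasure_eq_measure\<close>)
  then have "AE x in M. \<forall>N. x \<notin> (\<Inter>n\<in>{N..}. space M - A n)"
    by (simp add: AE_all_countable)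
  then show ?thesis
    using AE_space
  proof eventually_elim
    case (elim x)
    then show ?case by (auto simp: frequently_sequentially)
  qed
qed

section \<open>Block sums of i.i.d. variables\<close>

locale iid_sequence = prob_space +
  fixes Y :: "nat \<Rightarrow> 'a \<Rightarrow> real"
  assumes indep: "indep_vars (\<lambda>_. borel) Y UNIV"
    and distr_eq: "distr M borel (Y i) = distr M borel (Y 0)"
begin

lemma rv [measurable]: "random_variable borel (Y i)"
  using indep unfolding indep_vars_def by auto

lemma expectation_eq:
  fixes g :: "real \<Rightarrow> real"
  assumes [measurable]: "g \<in> borel_measurable borel"
  shows "expectation (\<lambda>\<omega>. g (Y i \<omega>)) = expectation (\<lambda>\<omega>. g (Y 0 \<omega>))"
proof -
  have "expectation (\<lambda>\<omega>. g (Y i \<omega>)) = integral\<^sup>L (distr M borel (Y i)) g" for i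
    by (subst integral_distr) auto
  then show ?thesis using distr_eq[of i] by simp
qed

definition partial_sum :: "nat \<Rightarrow> 'a \<Rightarrow> real" where
  "partial_sum n \<omega> = (\<Sum>i<n. Y i \<omega>)"

lemma partial_sum_measurable [measurable]: "random_variable borel (partial_sum n)"
  unfolding partial_sum_def[abs_def] by measurable

lemma partial_sum_add:
  "partial_sum (a + b) \<omega> = partial_sum a \<omega> + (\<Sum>i\<in>{a..<a+b}. Y i \<omega>)"
proof -
  have "(\<Sum>i\<in>{..<a} \<union> {a..<a+b}. Y i \<omega>) = partial_sum a \<omega> + (\<Sum>i\<in>{a..<a+b}. Y i \<omega>)"
    unfolding partial_sum_def by (rule sum.union_disjoint) auto
  moreover have "{..<a} \<union> {a..<a+b} = {..<a+b}" by auto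
  ultimately show ?thesis by (simp add: partial_sum_def)
qed

text \<open>Both laws are the n-fold convolution of the law of \<open>Y 0\<close>. The recursion
  \<open>step\<close> holds for every starting index and is used at \<open>a\<close> and at
  0.\<close>

lemma distr_block:
  "distr M borel (\<lambda>\<omega>. \<Sum>i\<in>{a..<a+n}. Y i \<omega>) = distr M borel (partial_sum n)"
proof (induction n)
  case 0
  then show ?case by (simp add: partial_sum_def[abs_def])
next
  case (Suc n)
  have step: "distr M borel (\<lambda>\<omega>. \<Sum>i\<in>{a..<a + Suc n}. Y i \<omega>)
      = (distr M borel (Y 0) \<star> distr M borel (\<lambda>\<omega>. \<Sum>i\<in>{a..<a+n}. Y i \<omega>))" for a
  proof -
    have ind: "indep_var borel (Y (a+n)) borel (\<lambda>\<omega>. \<Sum>i\<in>{a..<a+n}. Y i \<omega>)"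
      by (rule indep_vars_sum) (auto intro: indep_vars_subset[OF indep])
    have "distr M borel (\<lambda>\<omega>. \<Sum>i\<in>{a..<a + Suc n}. Y i \<omega>)
        = distr M borel (\<lambda>\<omega>. Y (a+n) \<omega> + (\<Sum>i\<in>{a..<a+n}. Y i \<omega>))"
      by (simp add: add.commute)
    also have "\<dots> = (distr M borel (Y (a+n)) \<star> distr M borel (\<lambda>\<omega>. \<Sum>i\<in>{a..<a+n}. Y i \<omega>))"
      by (rule sum_indep_random_variable[OF ind]) auto
    finally show ?thesis by (simp only: distr_eq[of "a+n"])
  qed
  have "partial_sum = (\<lambda>n \<omega>. \<Sum>i\<in>{0..<0+n}. Y i \<omega>)"
    by (simp add: partial_sum_def fun_eq_iff lessThan_atLeast0)
  then show ?case using step[of a] step[of 0] Suc by simp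
qed

lemma prob_block:
  assumes [measurable]: "Measurable.pred borel P"
  shows "prob {\<omega>\<in>space M. P (\<Sum>i\<in>{a..<a+n}. Y i \<omega>)} = prob {\<omega>\<in>space M. P (partial_sum n \<omega>)}"
proof -
  have "prob {\<omega>\<in>space M. P (\<Sum>i\<in>{a..<a+n}. Y i \<omega>)}
      = measure (distr M borel (\<lambda>\<omega>. \<Sum>i\<in>{a..<a+n}. Y i \<omega>)) {y. P y}"
    by (subst measure_distr) (auto intro!: arg_cong[where f=prob])
  also have "\<dots> = prob {\<omega>\<in>space M. P (partial_sum n \<omega>)}"
    unfolding distr_block by (subst measure_distr) (auto intro!: arg_cong[where f=prob])
  finally show ?thesis .
qed

text \<open>One way to exceed u + v is that the first a terms exceed u and the next b terms exceed
  v; these two events are independent, and the second has the probability of an initial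
  block.\<close>

lemma prob_partial_sum_superadditive:
  "prob {\<omega>\<in>space M. u \<le> partial_sum a \<omega>} * prob {\<omega>\<in>space M. v \<le> partial_sum b \<omega>}
     \<le> prob {\<omega>\<in>space M. u + v \<le> partial_sum (a + b) \<omega>}"
proof -
  let ?T = "\<lambda>\<omega>. \<Sum>i\<in>{a..<a+b}. Y i \<omega>"
  have "indep_var (PiM {..<a} (\<lambda>_. borel)) (\<lambda>\<omega>. restrict (\<lambda>i. Y i \<omega>) {..<a})
                  (PiM {a..<a+b} (\<lambda>_. borel)) (\<lambda>\<omega>. restrict (\<lambda>i. Y i \<omega>) {a..<a+b})"
    by (rule indep_var_restrict[OF indep]) auto
  then have "indep_var borel ((\<lambda>y. \<Sum>i<a. y i) \<circ> (\<lambda>\<omega>. restrict (\<lambda>i. Y i \<omega>) {..<a}))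
      borel ((\<lambda>y. \<Sum>i\<in>{a..<a+b}. y i) \<circ> (\<lambda>\<omega>. restrict (\<lambda>i. Y i \<omega>) {a..<a+b}))"
    by (rule indep_var_compose) (auto intro!: borel_measurable_sum measurable_component_singleton)
  then have ind: "indep_var borel (partial_sum a) borel ?T"
    by (simp add: comp_def partial_sum_def[abs_def])
  have "prob {\<omega>\<in>space M. u \<le> partial_sum a \<omega>} * prob {\<omega>\<in>space M. v \<le> partial_sum b \<omega>}
      = prob {\<omega>\<in>space M. partial_sum a \<omega> \<in> {u..}} * prob {\<omega>\<in>space M. ?T \<omega> \<in> {v..}}"
    by (simp add: prob_block)
  also have "\<dots> = prob {\<omega>\<in>space M. partial_sum a \<omega> \<in> {u..} \<and> ?T \<omega> \<in> {v..}}"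
    using prob_indep_random_variable[OF ind, of "{u..}" "{v..}"] by simp
  also have "\<dots> \<le> prob {\<omega>\<in>space M. u + v \<le> partial_sum (a + b) \<omega>}"
    by (intro finite_measure_mono) (auto simp: partial_sum_add)
  finally show ?thesis .
qed

text \<open>Iterating over r consecutive blocks of length l. This is the device that replaces a
  change of measure in the lower bound.\<close>

lemma prob_partial_sum_power:
  "prob {\<omega>\<in>space M. u \<le> partial_sum l \<omega>} ^ r \<le> prob {\<omega>\<in>space M. real r * u \<le> partial_sum (r * l) \<omega>}"
proof (induction r)
  case 0
  then show ?case by (simp add: partial_sum_def prob_space)
next
  case (Suc r)
  have "prob {\<omega>\<in>space M. u \<le> partial_sum l \<omega>} ^ Suc r
      \<le> prob {\<omega>\<in>space M. u \<le> partial_sum l \<omega>} * prob {\<omega>\<in>space M. real r * u \<le> partial_sum (r * l) \<omega>}"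
    using Suc by (simp add: mult_left_mono)
  also have "\<dots> \<le> prob {\<omega>\<in>space M. u + real r * u \<le> partial_sum (l + r * l) \<omega>}"
    by (rule prob_partial_sum_superadditive)
  finally show ?case by (simp add: algebra_simps)
qed

end

text \<open>
  Freezing the exponential of the partial sums at the first passage above \<open>a\<close> keeps its expectation
  below \<open>\<phi>\<^sup>n\<close> and makes it at least \<open>exp (s * a)\<close> once the level has been crossed, so that the
  maximal inequality reduces to that of Markov.
\<close>

primrec stopped_exp :: "real \<Rightarrow> real \<Rightarrow> nat \<Rightarrow> (nat \<Rightarrow> real) \<Rightarrow> real" where
  "stopped_exp s a 0 y = 1"
| "stopped_exp s a (Suc j) y = stopped_exp s a j y *
     (if \<exists>i\<le>j. a \<le> (\<Sum>k<i. y k) then 1 else exp (s * y j))"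

lemma stopped_exp_nonneg: "0 \<le> stopped_exp s a j y"
  by (induction j) auto

lemma stopped_exp_not_crossed:
  "(\<And>i. i < j \<Longrightarrow> (\<Sum>k<i. y k) < a) \<Longrightarrow> stopped_exp s a j y = exp (s * (\<Sum>k<j. y k))"
proof (induction j)
  case (Suc j)
  then have nc: "\<not> (\<exists>i\<le>j. a \<le> (\<Sum>k<i. y k))"
    by (meson le_imp_less_Suc linorder_not_le)
  have "stopped_exp s a j y = exp (s * (\<Sum>k<j. y k))"
    using Suc by simp
  with nc show ?case
    by (simp only: stopped_exp.simps if_False sum.lessThan_Suc distrib_left exp_add)
qed simp

lemma stopped_exp_crossed:
  assumes "0 \<le> s" "\<exists>i\<le>j. a \<le> (\<Sum>k<i. y k)"
  shows "exp (s * a) \<le> stopped_exp s a j y"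
  using assms(2)
proof (induction j)
  case 0
  \<comment> \<open>Crossing at time 0 means that the empty sum reaches the level, so a \<le> 0 and
    exp (s * a) \<le> 1.\<close>
  then show ?case using stopped_exp_not_crossed[of 0 y a s] assms(1) by (auto simp: mult_nonneg_nonpos)
next
  case (Suc j)
  show ?case
  proof (cases "\<exists>i\<le>j. a \<le> (\<Sum>k<i. y k)")
    case True
    then show ?thesis using Suc.IH by auto
  next
    case False
    then have c: "a \<le> (\<Sum>k<Suc j. y k)" using Suc.prems le_Suc_eq by metis
    have "stopped_exp s a (Suc j) y = exp (s * (\<Sum>k<Suc j. y k))"
      by (rule stopped_exp_not_crossed) (meson False less_Suc_eq_le not_le)
    then show ?thesis using c assms(1) by (simp add: mult_left_mono del: sum.lessThan_Suc)
  qed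
qed

text \<open>Stage j looks only at the coordinates below j, which is what makes it independent of the
  next variable.\<close>

lemma stopped_exp_cong:
  "(\<And>k. k < j \<Longrightarrow> y k = y' k) \<Longrightarrow> stopped_exp s a j y = stopped_exp s a j y'"
proof (induction j)
  case (Suc j)
  have "(\<Sum>k<i. y k) = (\<Sum>k<i. y' k)" if "i \<le> j" for i
    using Suc.prems that by (intro sum.cong) auto
  with Suc show ?case by (auto cong: conj_cong)
qed simp

lemma stopped_exp_measurable:
  "j \<le> n \<Longrightarrow> stopped_exp s a j \<in> borel_measurable (PiM {..<n} (\<lambda>_. borel))"
proof (induction j)
  case 0
  have "stopped_exp s a 0 = (\<lambda>_. 1)" by (rule ext) simp
  then show ?case by simp
next
  case (Suc j)
  have [measurable]: "stopped_exp s a j \<in> borel_measurable (PiM {..<n} (\<lambda>_. borel))"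
    using Suc by simp
  have [measurable]: "(\<lambda>y. y j) \<in> borel_measurable (PiM {..<n} (\<lambda>_. borel :: real measure))"
    using Suc.prems by (intro measurable_component_singleton) auto
  have [measurable]: "(\<lambda>y. \<Sum>k<i. y k) \<in> borel_measurable (PiM {..<n} (\<lambda>_. borel :: real measure))"
    if "i \<in> {..j}" for i
    using Suc.prems that by (intro borel_measurable_sum measurable_component_singleton) auto
  have "Measurable.pred (PiM {..<n} (\<lambda>_. borel)) (\<lambda>y. \<exists>i\<in>{..j}. a \<le> (\<Sum>k<i. y k :: real))"
    by measurable
  then have [measurable]: "Measurable.pred (PiM {..<n} (\<lambda>_. borel)) (\<lambda>y. \<exists>i\<le>j. a \<le> (\<Sum>k<i. y k :: real))"
    by (simp add: Bex_def)
  show ?case unfolding stopped_exp.simps by measurable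
qed

section \<open>Gaussian tails and the choice of a sparse geometric scale\<close>

text \<open>On the unit interval to the right of z the density is smallest at z + 1. The bound is
  crude, but only the leading term of the exponent matters.\<close>

lemma std_normal_upper_tail:
  assumes z: "0 \<le> z"
  shows "std_normal_density (z + 1) \<le> 1 - cdf std_normal_distribution z"
proof -
  interpret N: real_distribution std_normal_distribution by (rule real_dist_normal_dist)
  have "std_normal_density (z + 1) = (\<integral>x. std_normal_density (z + 1) * indicator {z<..z+1} x \<partial>lborel)"
    by simp
  also have "\<dots> \<le> (\<integral>x. std_normal_density x * indicator {z<..z+1} x \<partial>lborel)"
  proof (rule integral_mono)
    show "integrable lborel (\<lambda>x. std_normal_density x * indicator {z<..z+1} x)"
      by (rule integrable_real_mult_indicator) auto
    fix x :: real
    have "(x\<^sup>2 \<le> (z+1)\<^sup>2)" if "z < x" "x \<le> z + 1"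
      using that z by (intro power_mono) auto
    then show "std_normal_density (z + 1) * indicator {z<..z+1} x \<le> std_normal_density x * indicator {z<..z+1} x"
      by (auto simp: indicator_def std_normal_density_def field_simps)
  qed simp
  also have "\<dots> = measure std_normal_distribution {z<..z+1}"
    using integral_density[of "\<lambda>x. indicator {z<..z+1} x :: real" lborel std_normal_density] by simp
  also have "\<dots> \<le> measure std_normal_distribution {z<..}"
    by (intro N.finite_measure_mono) auto
  also have "{z<..} = space std_normal_distribution - {..z}" by auto
  also have "measure std_normal_distribution \<dots> = 1 - cdf std_normal_distribution z"
    unfolding cdf_def by (intro N.prob_compl) simp
  finally show ?thesis .
qed

lemma std_normal_upper_tail_eventually:
  assumes "\<delta> > 0"
  shows "\<forall>\<^sub>F z in at_top. exp (- (1 + \<delta>) * z\<^sup>2 / 2) < 1 - cdf std_normal_distribution z"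
proof -
  have "filterlim (\<lambda>z::real. (1 + \<delta>) * z\<^sup>2 / 2 - (z + 1)\<^sup>2 / 2) at_top at_top"
    using assms by real_asymp
  then have "\<forall>\<^sub>F z::real in at_top. ln (sqrt (2 * pi)) < (1 + \<delta>) * z\<^sup>2 / 2 - (z + 1)\<^sup>2 / 2"
    by (simp add: filterlim_at_top_dense)
  then show ?thesis using eventually_ge_at_top[of 0]
  proof eventually_elim
    case (elim z)
    have "exp (- (1 + \<delta>) * z\<^sup>2 / 2) < exp (- ln (sqrt (2 * pi)) + - (z + 1)\<^sup>2 / 2)"
    proof -
      have "- (1 + \<delta>) * z\<^sup>2 / 2 = - ((1 + \<delta>) * z\<^sup>2 / 2)" "- (z + 1)\<^sup>2 / 2 = - ((z + 1)\<^sup>2 / 2)"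
        by (simp_all add: field_simps)
      then show ?thesis using elim(1) by (subst exp_less_cancel_iff) linarith
    qed
    also have "\<dots> = std_normal_density (z + 1)"
      by (simp add: std_normal_density_def exp_add exp_minus exp_diff inverse_eq_divide)
    also have "\<dots> \<le> 1 - cdf std_normal_distribution z"
      by (rule std_normal_upper_tail) fact
    finally show ?case .
  qed
qed

text \<open>Deterministic bookkeeping for \<open>LIL_lower\<close>: the block between q^k and
  q^(k+1) contributes d, while the sum up to q^k may subtract up to 2 in its own, much smaller,
  scale. The 2 is the constant with which the upper half is applied to the negated
  variables.\<close>

lemma sparse_subsequence_factor:
  fixes c d :: real
  assumes "0 < c" "c < d"
  obtains q :: nat where "2 \<le> q"
    and "\<forall>\<^sub>F k in sequentially. c * sqrt (2 * (real q ^ Suc k * ln (ln (real q ^ Suc k))))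
       \<le> d * sqrt (2 * ((real q ^ Suc k - real q ^ k) * ln (ln (real q ^ Suc k - real q ^ k)))) - 2 * sqrt (2 * (real q ^ k * ln (ln (real q ^ k))))"
proof -
  \<comment> \<open>Relative to q^(k+1) the block has weight sqrt ((q - 1) / q) and the past has
    weight 1 / sqrt q, so a large q leaves more than c.\<close>
  have "((\<lambda>x::real. (d * sqrt (x - 1) - 2) / sqrt x) \<longlongrightarrow> d) at_top"
    by real_asymp
  then have "\<forall>\<^sub>F x::real in at_top. c < (d * sqrt (x - 1) - 2) / sqrt x"
    by (rule order_tendstoD) fact
  then have "\<forall>\<^sub>F q in sequentially. c < (d * sqrt (real q - 1) - 2) / sqrt q"
    by (rule eventually_compose_filterlim) (rule filterlim_real_sequentially)
  then obtain q :: nat where q: "2 \<le> q" "c < (d * sqrt (real q - 1) - 2) / sqrt q"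
    using eventually_happens'[OF sequentially_bot eventually_conj[OF eventually_ge_at_top[of 2]]] by blast
  define e where "e = d * sqrt (real q - 1) - 2"
  have e: "c * sqrt q < e" "0 < e"
  proof -
    show *: "c * sqrt q < e" using q by (simp add: e_def field_simps)
    have "0 < c * sqrt q" using assms(1) q by simp
    with * show "0 < e" by linarith
  qed
  have lnq: "0 < ln (real q)" using q by simp
  \<comment> \<open>The iterated logarithms at q^(k+1) and q^k are asymptotically equal; the strict
    gap between \<open>c * sqrt q\<close> and \<open>e\<close> absorbs their ratio.\<close>
  have lim: "(\<lambda>k. sqrt (ln (real (Suc k) * ln q)) / sqrt (ln (real k * ln q))) \<longlonglongrightarrow> 1"
    using lnq by real_asymp
  have ratio: "1 < e / (c * sqrt q)" using e assms(1) q by (simp add: field_simps)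
  have ev: "\<forall>\<^sub>F k in sequentially. sqrt (ln (real (Suc k) * ln q)) / sqrt (ln (real k * ln q)) < e / (c * sqrt q)"
    using lim ratio by (rule order_tendstoD)
  have pos: "\<forall>\<^sub>F k in sequentially. 0 < ln (real k * ln q)"
    using lnq by real_asymp
  show ?thesis
  proof (rule that[OF q(1)])
    show "\<forall>\<^sub>F k in sequentially. c * sqrt (2 * (real q ^ Suc k * ln (ln (real q ^ Suc k))))
       \<le> d * sqrt (2 * ((real q ^ Suc k - real q ^ k) * ln (ln (real q ^ Suc k - real q ^ k)))) - 2 * sqrt (2 * (real q ^ k * ln (ln (real q ^ k))))"
      using ev pos eventually_gt_at_top[of 0]
    proof eventually_elim
      case (elim k)
      let ?L = "\<lambda>k. ln (real k * ln q)" and ?N = "real q ^ Suc k - real q ^ k"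
      have Q: "0 < real q ^ k" using q by simp
      have N_eq: "?N = real q ^ k * (real q - 1)" by (simp add: algebra_simps)
      have N_ge: "real q ^ k \<le> ?N"
        unfolding N_eq using mult_left_mono[of 1 "real q - 1" "real q ^ k"] q by simp
      have ln_pow: "ln (real q ^ j) = real j * ln q" for j using q by (simp add: ln_realpow)
      have lnk0: "0 < real k * ln q" using elim lnq by simp
      have "real k * ln q \<le> ln ?N"
        using ln_mono[OF N_ge Q] by (simp add: ln_pow)
      then have lnN: "?L k \<le> ln (ln ?N)" using lnk0 by (rule ln_mono)
      have "sqrt (?L (Suc k)) < e / (c * sqrt q) * sqrt (?L k)"
        using elim by (simp add: divide_less_eq)
      then have "c * sqrt q * sqrt (?L (Suc k)) \<le> e * sqrt (?L k)"
        using assms(1) q by (simp add: field_simps)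
      then have key: "c * sqrt q * sqrt (?L (Suc k)) \<le> d * sqrt (real q - 1) * sqrt (?L k) - 2 * sqrt (?L k)"
        by (simp add: e_def algebra_simps)
      let ?w = "sqrt (2 * real q ^ k)"
      have "c * sqrt (2 * (real q ^ Suc k * ln (ln (real q ^ Suc k)))) = ?w * (c * sqrt q * sqrt (?L (Suc k)))"
        unfolding ln_pow by (simp add: real_sqrt_mult)
      also have "\<dots> \<le> ?w * (d * sqrt (real q - 1) * sqrt (?L k) - 2 * sqrt (?L k))"
        using key by (intro mult_left_mono) auto
      also have "\<dots> = d * sqrt (2 * (?N * ?L k)) - 2 * sqrt (2 * (real q ^ k * ln (ln (real q ^ k))))"
        unfolding ln_pow N_eq right_diff_distrib[of ?w] by (simp add: real_sqrt_mult)
      also have "\<dots> \<le> d * sqrt (2 * (?N * ln (ln ?N))) - 2 * sqrt (2 * (real q ^ k * ln (ln (real q ^ k))))"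
      proof -
        have "?N * ?L k \<le> ?N * ln (ln ?N)" using lnN N_ge Q by (intro mult_left_mono) auto
        then show ?thesis using assms by (auto intro!: mult_left_mono)
      qed
      finally show ?case by simp
    qed
  qed
qed

section \<open>Exponential moments and the maximal inequality\<close>

locale bounded_centred_iid = iid_sequence +
  fixes B \<sigma> :: real
  assumes bounded: "\<omega> \<in> space M \<Longrightarrow> \<bar>Y i \<omega>\<bar> \<le> B"
    and mean_zero: "expectation (Y 0) = 0"
    and second_moment: "expectation (\<lambda>\<omega>. (Y 0 \<omega>)\<^sup>2) = \<sigma>\<^sup>2"
    and sigma_pos: "\<sigma> > 0"
begin

lemma B_nonneg: "0 \<le> B"
proof -
  obtain \<omega> where "\<omega> \<in> space M" using not_empty by blast
  from bounded[OF this, of 0] show ?thesis by linarith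
qed

lemma integrable_Y_comp:
  fixes g :: "real \<Rightarrow> real"
  assumes [measurable]: "g \<in> borel_measurable borel" and "\<And>y. \<bar>y\<bar> \<le> B \<Longrightarrow> \<bar>g y\<bar> \<le> C"
  shows "integrable M (\<lambda>\<omega>. g (Y i \<omega>))"
proof (rule integrable_const_bound[where B=C])
  show "AE \<omega> in M. norm (g (Y i \<omega>)) \<le> C"
    by (rule AE_I2) (simp add: assms(2) bounded)
qed measurable

text \<open>Centring removes the linear term of the quadratic bound on exp. As s tends to 0 the
  factor exp (s * B) tends to 1 and the exponent becomes the Gaussian one, as a sharp iterated
  logarithm requires.\<close>

lemma mgf_bound:
  assumes s: "0 \<le> s"
  shows "expectation (\<lambda>\<omega>. exp (s * Y i \<omega>)) \<le> exp (s\<^sup>2 * \<sigma>\<^sup>2 * exp (s * B) / 2)"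
proof -
  let ?q = "\<lambda>y. 1 + s * y + s\<^sup>2 * exp (s * B) / 2 * y\<^sup>2"
  have *: "exp (s * y) \<le> ?q y" if "\<bar>y\<bar> \<le> B" for y
  proof -
    have "exp (s * y) \<le> 1 + s * y + (s * y)\<^sup>2 / 2 * exp \<bar>s * y\<bar>"
      by (rule exp_le_quadratic)
    also have "(s * y)\<^sup>2 / 2 * exp \<bar>s * y\<bar> \<le> (s * y)\<^sup>2 / 2 * exp (s * B)"
      using that s by (intro mult_left_mono) (auto simp: abs_mult intro!: mult_left_mono)
    finally show ?thesis by (simp add: power_mult_distrib field_simps)
  qed
  have int1: "integrable M (Y 0)" by (rule integrable_Y_comp[of "\<lambda>y. y" B]) auto
  have int2: "integrable M (\<lambda>\<omega>. (Y 0 \<omega>)\<^sup>2)"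
    by (rule integrable_Y_comp[of "\<lambda>y. y\<^sup>2" "B\<^sup>2"]) (auto simp: abs_le_square_iff[symmetric] B_nonneg)
  have "expectation (\<lambda>\<omega>. exp (s * Y i \<omega>)) = expectation (\<lambda>\<omega>. exp (s * Y 0 \<omega>))"
    by (rule expectation_eq) simp
  also have "\<dots> \<le> expectation (\<lambda>\<omega>. ?q (Y 0 \<omega>))"
  proof (rule integral_mono)
    show "integrable M (\<lambda>\<omega>. exp (s * Y 0 \<omega>))"
      by (rule integrable_Y_comp[of "\<lambda>y. exp (s * y)" "exp (s * B)"])
        (use s in \<open>auto intro!: mult_left_mono\<close>)
  qed (use int1 int2 * bounded in auto)
  also have "\<dots> = 1 + s\<^sup>2 * exp (s * B) / 2 * \<sigma>\<^sup>2"
    using int1 int2 by (simp add: mean_zero second_moment prob_space)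
  also have "\<dots> \<le> exp (s\<^sup>2 * exp (s * B) / 2 * \<sigma>\<^sup>2)"
    by (rule exp_ge_add_one_self)
  finally show ?thesis by (simp add: field_simps)
qed

text \<open>The next stage leaves the part that has crossed (\<open>U\<close>) alone and multiplies
  the other part (\<open>V\<close>) by an independent factor of mean at most
  \<open>\<phi>\<close>.\<close>

lemma stopped_exp_expectation:
  assumes s: "0 \<le> s" and phi: "\<And>i. expectation (\<lambda>\<omega>. exp (s * Y i \<omega>)) \<le> \<phi>" "1 \<le> \<phi>"
  shows "integrable M (\<lambda>\<omega>. stopped_exp s a n (\<lambda>i. Y i \<omega>)) \<and>
         expectation (\<lambda>\<omega>. stopped_exp s a n (\<lambda>i. Y i \<omega>)) \<le> \<phi> ^ n"
proof (induction n)
  case 0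
  then show ?case by (simp add: prob_space)
next
  case (Suc n)
  define c where "c y \<longleftrightarrow> (\<exists>i\<in>{..n}. a \<le> (\<Sum>k<i. y k :: real))" for y
  define W where "W y = stopped_exp s a n y" for y
  define U where "U y = W y * of_bool (c y)" for y
  define V where "V y = W y * of_bool (\<not> c y)" for y
  let ?P = "PiM {..<n} (\<lambda>_. borel :: real measure)"
  have [measurable]: "W \<in> borel_measurable ?P"
    unfolding W_def by (rule stopped_exp_measurable) simp
  have [measurable]: "(\<lambda>y. \<Sum>k<i. y k) \<in> borel_measurable ?P" if "i \<in> {..n}" for i
    using that by (intro borel_measurable_sum measurable_component_singleton) auto
  have [measurable]: "Measurable.pred ?P c" unfolding c_def[abs_def] by measurable
  have UVm [measurable]: "U \<in> borel_measurable ?P" "V \<in> borel_measurable ?P"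
    unfolding U_def[abs_def] V_def[abs_def] by measurable
  have csum: "c y = c y'" if "\<And>k. k < n \<Longrightarrow> y k = y' k" for y y'
  proof -
    have "(\<Sum>k<i. y k) = (\<Sum>k<i. y' k)" if "i \<le> n" for i
      using that \<open>\<And>k. k < n \<Longrightarrow> y k = y' k\<close> by (intro sum.cong) auto
    then show ?thesis by (simp add: c_def)
  qed
  have Wr: "W (restrict y {..<n}) = W y" and cr: "c (restrict y {..<n}) = c y" for y
    unfolding W_def by (auto intro!: stopped_exp_cong csum)
  have UVr: "U (restrict y {..<n}) = U y" "V (restrict y {..<n}) = V y" for y
    by (simp_all add: U_def V_def Wr cr)
  have [measurable]: "(\<lambda>\<omega>. restrict (\<lambda>i. Y i \<omega>) {..<n}) \<in> measurable M ?P"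
    by (rule measurable_restrict) simp
  have [measurable]: "(\<lambda>\<omega>. U (\<lambda>i. Y i \<omega>)) \<in> borel_measurable M" "(\<lambda>\<omega>. V (\<lambda>i. Y i \<omega>)) \<in> borel_measurable M"
    using measurable_compose[OF \<open>(\<lambda>\<omega>. restrict (\<lambda>i. Y i \<omega>) {..<n}) \<in> measurable M ?P\<close> UVm(1)]
      measurable_compose[OF \<open>(\<lambda>\<omega>. restrict (\<lambda>i. Y i \<omega>) {..<n}) \<in> measurable M ?P\<close> UVm(2)]
    by (simp_all add: UVr)
  have W_int: "integrable M (\<lambda>\<omega>. W (\<lambda>i. Y i \<omega>))" and W_le: "expectation (\<lambda>\<omega>. W (\<lambda>i. Y i \<omega>)) \<le> \<phi> ^ n"
    using Suc by (auto simp: W_def)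
  have W0: "0 \<le> W y" for y unfolding W_def by (rule stopped_exp_nonneg)
  have U_int: "integrable M (\<lambda>\<omega>. U (\<lambda>i. Y i \<omega>))" and V_int: "integrable M (\<lambda>\<omega>. V (\<lambda>i. Y i \<omega>))"
  proof -
    show "integrable M (\<lambda>\<omega>. U (\<lambda>i. Y i \<omega>))"
    proof (rule Bochner_Integration.integrable_bound[OF W_int])
      show "AE \<omega> in M. norm (U (\<lambda>i. Y i \<omega>)) \<le> norm (W (\<lambda>i. Y i \<omega>))"
        by (simp add: U_def W0)
    qed measurable
    show "integrable M (\<lambda>\<omega>. V (\<lambda>i. Y i \<omega>))"
    proof (rule Bochner_Integration.integrable_bound[OF W_int])
      show "AE \<omega> in M. norm (V (\<lambda>i. Y i \<omega>)) \<le> norm (W (\<lambda>i. Y i \<omega>))"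
        by (simp add: V_def W0)
    qed measurable
  qed
  have e_int: "integrable M (\<lambda>\<omega>. exp (s * Y n \<omega>))"
    by (rule integrable_Y_comp[of "\<lambda>y. exp (s * y)" "exp (s * B)"])
      (use s in \<open>auto intro!: mult_left_mono\<close>)
  have "indep_var ?P (\<lambda>\<omega>. restrict (\<lambda>i. Y i \<omega>) {..<n}) (PiM {n} (\<lambda>_. borel)) (\<lambda>\<omega>. restrict (\<lambda>i. Y i \<omega>) {n})"
    by (rule indep_var_restrict[OF indep]) auto
  then have "indep_var borel (V \<circ> (\<lambda>\<omega>. restrict (\<lambda>i. Y i \<omega>) {..<n}))
      borel ((\<lambda>y. exp (s * y n)) \<circ> (\<lambda>\<omega>. restrict (\<lambda>i. Y i \<omega>) {n}))"
    by (rule indep_var_compose) (use UVm in \<open>auto intro!: measurable_component_singleton\<close>)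
  then have ind: "indep_var borel (\<lambda>\<omega>. V (\<lambda>i. Y i \<omega>)) borel (\<lambda>\<omega>. exp (s * Y n \<omega>))"
    by (simp add: comp_def UVr)
  have split: "stopped_exp s a (Suc n) y = U y + V y * exp (s * y n)" for y
    by (auto simp: U_def V_def W_def c_def)
  have int: "integrable M (\<lambda>\<omega>. V (\<lambda>i. Y i \<omega>) * exp (s * Y n \<omega>))"
    by (rule indep_var_integrable[OF ind V_int e_int])
  have "expectation (\<lambda>\<omega>. stopped_exp s a (Suc n) (\<lambda>i. Y i \<omega>))
      = expectation (\<lambda>\<omega>. U (\<lambda>i. Y i \<omega>)) + expectation (\<lambda>\<omega>. V (\<lambda>i. Y i \<omega>)) * expectation (\<lambda>\<omega>. exp (s * Y n \<omega>))"
    unfolding split using U_int int by (simp add: indep_var_lebesgue_integral[OF ind V_int e_int])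
  also have "\<dots> \<le> \<phi> * expectation (\<lambda>\<omega>. U (\<lambda>i. Y i \<omega>)) + expectation (\<lambda>\<omega>. V (\<lambda>i. Y i \<omega>)) * \<phi>"
  proof (rule add_mono)
    have "0 \<le> expectation (\<lambda>\<omega>. U (\<lambda>i. Y i \<omega>))" "0 \<le> expectation (\<lambda>\<omega>. V (\<lambda>i. Y i \<omega>))"
      by (simp_all add: U_def V_def W0)
    then show "expectation (\<lambda>\<omega>. U (\<lambda>i. Y i \<omega>)) \<le> \<phi> * expectation (\<lambda>\<omega>. U (\<lambda>i. Y i \<omega>))"
      "expectation (\<lambda>\<omega>. V (\<lambda>i. Y i \<omega>)) * expectation (\<lambda>\<omega>. exp (s * Y n \<omega>))
        \<le> expectation (\<lambda>\<omega>. V (\<lambda>i. Y i \<omega>)) * \<phi>"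
      using phi mult_right_mono[of 1 \<phi>] by (auto intro: mult_left_mono)
  qed
  also have "\<dots> = \<phi> * expectation (\<lambda>\<omega>. U (\<lambda>i. Y i \<omega>) + V (\<lambda>i. Y i \<omega>))"
    using U_int V_int by (simp add: algebra_simps)
  also have "(\<lambda>\<omega>. U (\<lambda>i. Y i \<omega>) + V (\<lambda>i. Y i \<omega>)) = (\<lambda>\<omega>. W (\<lambda>i. Y i \<omega>))"
    by (auto simp: U_def V_def)
  also have "\<phi> * expectation (\<lambda>\<omega>. W (\<lambda>i. Y i \<omega>)) \<le> \<phi> * \<phi> ^ n"
    using W_le phi(2) by (intro mult_left_mono) auto
  finally show ?case using U_int int unfolding split by simp
qed

text \<open>Markov's inequality for the stopped exponential at time n. The parameter s stays free
  and is tuned in \<open>LIL_upper\<close>.\<close>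

lemma maximal_inequality:
  assumes s: "0 \<le> s"
  shows "prob {\<omega>\<in>space M. \<exists>j\<in>{..n}. a \<le> partial_sum j \<omega>}
     \<le> exp (- s * a + real n * (s\<^sup>2 * \<sigma>\<^sup>2 * exp (s * B) / 2))"
proof -
  let ?\<phi> = "exp (s\<^sup>2 * \<sigma>\<^sup>2 * exp (s * B) / 2)" and ?W = "\<lambda>\<omega>. stopped_exp s a n (\<lambda>i. Y i \<omega>)"
  have E: "integrable M ?W" "expectation ?W \<le> ?\<phi> ^ n"
    using stopped_exp_expectation[OF s mgf_bound[OF s], of a n] by auto
  have [measurable]: "?W \<in> borel_measurable M" using E(1) by auto
  have "prob {\<omega>\<in>space M. \<exists>j\<in>{..n}. a \<le> partial_sum j \<omega>} \<le> prob {\<omega>\<in>space M. exp (s * a) \<le> ?W \<omega>}"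
    using stopped_exp_crossed[OF s, of n a "\<lambda>i. Y i _"]
    by (intro finite_measure_mono) (auto simp: partial_sum_def)
  also have "\<dots> \<le> expectation ?W / exp (s * a)"
    by (rule integral_Markov_inequality_measure[where A="{}"]) (auto simp: E stopped_exp_nonneg)
  also have "\<dots> \<le> ?\<phi> ^ n / exp (s * a)"
    using E(2) by (simp add: divide_right_mono)
  also have "\<dots> = exp (- s * a + real n * (s\<^sup>2 * \<sigma>\<^sup>2 * exp (s * B) / 2))"
    unfolding exp_of_nat_mult[symmetric] exp_diff[symmetric] by (simp add: algebra_simps)
  finally show ?thesis .
qed

text \<open>Lets the upper half bound the partial sums from below; \<open>LIL_lower\<close> needs
  this for the terms before a block.\<close>

lemma bounded_centred_iid_uminus: "bounded_centred_iid M (\<lambda>i \<omega>. - Y i \<omega>) B \<sigma>"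
proof unfold_locales
  show "indep_vars (\<lambda>_. borel) (\<lambda>i \<omega>. - Y i \<omega>) UNIV"
    by (rule indep_vars_compose2[OF indep]) auto
  have *: "distr M borel (\<lambda>\<omega>. - Y i \<omega>) = distr (distr M borel (Y i)) borel uminus" for i
    by (subst distr_distr) (auto simp: comp_def)
  show "distr M borel (\<lambda>\<omega>. - Y i \<omega>) = distr M borel (\<lambda>\<omega>. - Y 0 \<omega>)" for i
    unfolding * using distr_eq[of i] by simp
qed (use bounded mean_zero second_moment sigma_pos in auto)

section \<open>Upper half of the law of the iterated logarithm\<close>

text \<open>For l^k \<le> n < l^(k+1) the level is taken at the left end and the maximum up to the
  right end. This mismatch divides the exponent c^2 by l; since l < c^2, the probabilities still
  decay like k^(-p) with p > 1.\<close>

theorem LIL_upper: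
  assumes c: "1 < c"
  shows "AE \<omega> in M. \<forall>\<^sub>F n in sequentially. partial_sum n \<omega> \<le> c * \<sigma> * sqrt (2 * (n * ln (ln n)))"
proof -
  define l where "l = (1 + c\<^sup>2) / 2"
  have c2: "1 < c\<^sup>2" using c by (simp add: one_less_power)
  then have l: "1 < l" "l < c\<^sup>2" "0 < l" by (auto simp: l_def)
  define p where "p = (1 + c\<^sup>2 / l) / 2"
  have p: "1 < p" "p < c\<^sup>2 / l" using l by (auto simp: p_def field_simps)
  define L where "L k = ln (ln (l ^ k))" for k :: nat
  have L_eq: "L k = ln (k * ln l)" for k
    using l by (simp add: L_def ln_realpow)
  define a where "a k = c * \<sigma> * sqrt (2 * (l ^ k * L k))" for k
  define N where "N k = nat \<lfloor>l ^ Suc k\<rfloor>" for k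
  \<comment> \<open>Minimises - s a + N s^2 \<sigma>^2 / 2 with N replaced by l^(k+1), that is, the
    exponent of the maximal inequality without the factor exp (s * B).\<close>
  define s where "s k = a k / (l ^ Suc k * \<sigma>\<^sup>2)" for k
  define E where "E k = {\<omega>\<in>space M. \<exists>j\<in>{..N k}. a k \<le> partial_sum j \<omega>}" for k
  have [measurable]: "E k \<in> events" for k unfolding E_def by measurable
  have Lpos: "\<forall>\<^sub>F k in sequentially. 0 < L k"
    unfolding L_eq using l by real_asymp
  have s0: "s \<longlonglongrightarrow> 0"
  proof -
    have eq: "\<forall>\<^sub>F k in sequentially. s k = c / (l * \<sigma>) * sqrt (2 * (L k / l ^ k))"
      using Lpos
    proof eventually_elim
      case (elim k)
      have "sqrt (2 * (l ^ k * L k)) = sqrt ((l ^ k)\<^sup>2 * (2 * (L k / l ^ k)))"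
        using l by (simp add: power2_eq_square)
      also have "\<dots> = l ^ k * sqrt (2 * (L k / l ^ k))"
        unfolding real_sqrt_mult[of "(l ^ k)\<^sup>2"] using l by simp
      finally show ?case using l sigma_pos by (simp add: s_def a_def field_simps power2_eq_square)
    qed
    have "(\<lambda>k. L k / l ^ k) \<longlonglongrightarrow> 0"
      unfolding L_eq using l by real_asymp
    then have "(\<lambda>k. c / (l * \<sigma>) * sqrt (2 * (L k / l ^ k))) \<longlonglongrightarrow> c / (l * \<sigma>) * sqrt (2 * 0)"
      by (intro tendsto_intros)
    then show ?thesis using eq by (simp add: tendsto_cong)
  qed
  \<comment> \<open>This is the coefficient of \<open>L k\<close> in the exponent; since
    \<open>s k\<close> tends to 0, it tends to c^2 / l, which exceeds p.\<close>
  have "(\<lambda>k. 2 * c\<^sup>2 / l * (1 - exp (s k * B) / 2)) \<longlonglongrightarrow> 2 * c\<^sup>2 / l * (1 - exp (0 * B) / 2)"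
    by (intro tendsto_intros s0) simp
  then have "\<forall>\<^sub>F k in sequentially. p < 2 * c\<^sup>2 / l * (1 - exp (s k * B) / 2)"
    by (rule order_tendstoD) (use p in simp)
  then have bound: "\<forall>\<^sub>F k in sequentially. prob (E k) \<le> (k * ln l) powr (- p)"
    using Lpos eventually_gt_at_top[of 0]
  proof eventually_elim
    case (elim k)
    have a0: "0 \<le> a k" using c sigma_pos l elim by (simp add: a_def)
    have sk: "0 \<le> s k" using a0 l by (simp add: s_def)
    have a2: "(a k)\<^sup>2 = 2 * c\<^sup>2 * \<sigma>\<^sup>2 * l ^ k * L k"
      using l elim by (simp add: a_def power_mult_distrib)
    have "prob (E k) \<le> exp (- s k * a k + real (N k) * ((s k)\<^sup>2 * \<sigma>\<^sup>2 * exp (s k * B) / 2))"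
      unfolding E_def by (rule maximal_inequality[OF sk])
    also have "\<dots> \<le> exp (- s k * a k + l ^ Suc k * ((s k)\<^sup>2 * \<sigma>\<^sup>2 * exp (s k * B) / 2))"
    proof -
      have "real (N k) \<le> l ^ Suc k" using l by (simp add: N_def)
      then show ?thesis by (simp add: mult_right_mono del: power_Suc)
    qed
    also have "- s k * a k + l ^ Suc k * ((s k)\<^sup>2 * \<sigma>\<^sup>2 * exp (s k * B) / 2)
        = - ((a k)\<^sup>2 / (l ^ Suc k * \<sigma>\<^sup>2)) * (1 - exp (s k * B) / 2)"
      using l sigma_pos by (simp add: s_def field_simps power2_eq_square)
    also have "(a k)\<^sup>2 / (l ^ Suc k * \<sigma>\<^sup>2) = 2 * c\<^sup>2 / l * L k"
      using l sigma_pos unfolding a2 by (simp add: field_simps)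
    also have "- (2 * c\<^sup>2 / l * L k) * (1 - exp (s k * B) / 2)
        = - (2 * c\<^sup>2 / l * (1 - exp (s k * B) / 2)) * L k" by simp
    also have "exp \<dots> \<le> exp (- p * L k)"
      using mult_right_mono[of p "2 * c\<^sup>2 / l * (1 - exp (s k * B) / 2)" "L k"] elim by simp
    also have "\<dots> = (k * ln l) powr (- p)"
      using l elim by (simp add: L_eq powr_def)
    finally show ?case .
  qed
  have "summable (\<lambda>k. real k powr (- p))" using p by (simp add: summable_real_powr_iff)
  then have "summable (\<lambda>k. ln l powr (- p) * real k powr (- p))" by (rule summable_mult)
  then have "summable (\<lambda>k. (k * ln l) powr (- p))"
    using l by (simp add: powr_mult mult.commute)
  then have "summable (\<lambda>k. prob (E k))"
    by (rule summable_comparison_test_ev[rotated]) (use bound in simp)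
  then have "AE \<omega> in M. \<forall>\<^sub>F k in sequentially. \<omega> \<in> space M - E k"
    by (intro borel_cantelli_AE1) (auto simp: emeasure_eq_measure)
  then show ?thesis
  proof eventually_elim
    case (elim \<omega>)
    have "\<forall>\<^sub>F k in sequentially. 0 < L k \<and> \<omega> \<in> space M - E k \<and> 0 < k * ln l"
      using elim Lpos eventually_gt_at_top[of 0] by eventually_elim (use l in auto)
    then obtain K where K: "\<And>k. k \<ge> K \<Longrightarrow> 0 < L k \<and> \<omega> \<in> space M - E k \<and> 0 < k * ln l"
      unfolding eventually_sequentially by blast
    have "partial_sum n \<omega> \<le> c * \<sigma> * sqrt (2 * (n * ln (ln n)))" if n: "n \<ge> nat \<lceil>l ^ K\<rceil>" "n > 0" for n
    proof -
      define k where "k = nat \<lfloor>log l n\<rfloor>"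
      have "0 \<le> log l n" using l n by simp
      then have kl: "real k \<le> log l n" "log l n < real k + 1" unfolding k_def by linarith+
      have "l ^ k = l powr k" using l by (simp add: powr_realpow)
      also have "\<dots> \<le> n" using kl(1) l n by (simp add: le_log_iff)
      finally have lower: "l ^ k \<le> n" .
      have "real n < l powr (real k + 1)" using kl(2) l n by (simp add: log_less_iff)
      also have "\<dots> = l ^ Suc k" using l by (simp add: powr_realpow[symmetric] powr_add)
      finally have upper: "real n < l ^ Suc k" .
      have "l ^ K \<le> real n" using n by linarith
      then have "l ^ K < l ^ Suc k" using upper by linarith
      then have "K \<le> k" using l by (simp add: power_strict_increasing_iff del: power_Suc)
      note Kk = K[OF this]
      have "n \<le> N k" using upper unfolding N_def by linarith
      then have "partial_sum n \<omega> < a k" using Kk by (auto simp: E_def not_le)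
      also have "a k \<le> c * \<sigma> * sqrt (2 * (n * ln (ln n)))"
      proof -
        have ln0: "0 < ln (l ^ k)" using Kk l by (simp add: ln_realpow)
        have ln1: "ln (l ^ k) \<le> ln n" using lower l by (intro ln_mono) auto
        have "L k \<le> ln (ln n)" unfolding L_def by (rule ln_mono[OF ln1 ln0])
        then have "l ^ k * L k \<le> n * ln (ln n)" using lower Kk l by (intro mult_mono) auto
        then show ?thesis using c sigma_pos unfolding a_def by (intro mult_left_mono) auto
      qed
      finally show ?thesis by simp
    qed
    then show ?case unfolding eventually_sequentially
      by (meson Suc_leD Suc_le_lessD le_less_trans zero_le)
  qed
qed

section \<open>Moderate deviations and the lower half\<close>

text \<open>The level z is fixed before n grows. The strict Gaussian tail inequality at z survives
  the limit because the normal law has no atom there.\<close>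

lemma prob_partial_sum_ge_tail:
  assumes "\<delta> > 0"
  obtains z where "z > 0"
    and "\<forall>\<^sub>F n in sequentially. exp (- (1 + \<delta>) * z\<^sup>2 / 2) \<le> prob {\<omega>\<in>space M. z * \<sigma> * sqrt n \<le> partial_sum n \<omega>}"
proof -
  interpret N: real_distribution std_normal_distribution by (rule real_dist_normal_dist)
  obtain z where z: "z > 0" "exp (- (1 + \<delta>) * z\<^sup>2 / 2) < 1 - cdf std_normal_distribution z"
    using eventually_happens'[OF _ eventually_conj[OF std_normal_upper_tail_eventually[OF assms] eventually_gt_at_top[of 0]]]
    by auto
  have sq: "integrable M (\<lambda>\<omega>. (Y i \<omega>)\<^sup>2)" for i
    by (rule integrable_Y_comp[of "\<lambda>y. y\<^sup>2" "B\<^sup>2"]) (auto simp: abs_le_square_iff[symmetric] B_nonneg)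
  have "expectation (Y i) = 0" for i
    using expectation_eq[of "\<lambda>y. y" i] mean_zero by simp
  moreover have "expectation (\<lambda>\<omega>. (Y i \<omega>)\<^sup>2) = \<sigma>\<^sup>2" for i
    using expectation_eq[of "\<lambda>y. y\<^sup>2" i] second_moment by simp
  ultimately have "weak_conv_m (\<lambda>n. distr M borel (\<lambda>x. (\<Sum>i<n. Y i x) / sqrt (n * \<sigma>\<^sup>2))) std_normal_distribution"
    by (intro central_limit_theorem_zero_mean[OF indep _ sigma_pos sq _ distr_eq]) auto
  moreover have "isCont (cdf std_normal_distribution) z"
  proof (rule N.isCont_cdf[THEN iffD2])
    show "measure std_normal_distribution {z} = 0"
    proof -
      have "(LBINT x. std_normal_density x * indicat_real {z} x) = 0"
        by (rule integral_eq_zero_AE) (use AE_lborel_singleton[of z] in \<open>auto elim!: eventually_mono\<close>)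
      then show ?thesis
        using integral_density[of "\<lambda>x. indicator {z} x :: real" lborel std_normal_density] by simp
    qed
  qed
  ultimately have "(\<lambda>n. cdf (distr M borel (\<lambda>x. (\<Sum>i<n. Y i x) / sqrt (n * \<sigma>\<^sup>2))) z)
      \<longlonglongrightarrow> cdf std_normal_distribution z"
    unfolding weak_conv_m_def weak_conv_def by blast
  then have "\<forall>\<^sub>F n in sequentially. cdf (distr M borel (\<lambda>x. (\<Sum>i<n. Y i x) / sqrt (n * \<sigma>\<^sup>2))) z
      < 1 - exp (- (1 + \<delta>) * z\<^sup>2 / 2)"
    by (rule order_tendstoD) (use z in simp)
  then have "\<forall>\<^sub>F n in sequentially. exp (- (1 + \<delta>) * z\<^sup>2 / 2) \<le> prob {\<omega>\<in>space M. z * \<sigma> * sqrt n \<le> partial_sum n \<omega>}"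
    using eventually_gt_at_top[of 0]
  proof eventually_elim
    case (elim n)
    have pos: "0 < \<sigma> * sqrt n" using sigma_pos elim by simp
    have "cdf (distr M borel (\<lambda>x. (\<Sum>i<n. Y i x) / sqrt (n * \<sigma>\<^sup>2))) z
        = prob {\<omega>\<in>space M. partial_sum n \<omega> \<le> z * \<sigma> * sqrt n}"
      unfolding cdf_def using pos sigma_pos
      by (subst measure_distr)
        (auto intro!: arg_cong[where f=prob] simp: partial_sum_def real_sqrt_mult field_simps)
    moreover have "1 - prob {\<omega>\<in>space M. partial_sum n \<omega> \<le> z * \<sigma> * sqrt n}
        = prob (space M - {\<omega>\<in>space M. partial_sum n \<omega> \<le> z * \<sigma> * sqrt n})"
      by (rule prob_compl[symmetric]) simp
    moreover have "\<dots> \<le> prob {\<omega>\<in>space M. z * \<sigma> * sqrt n \<le> partial_sum n \<omega>}"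
      by (intro finite_measure_mono) auto
    ultimately show ?case using elim by linarith
  qed
  with z(1) show ?thesis by (rule that)
qed

text \<open>
  Splitting \<open>n\<close> into about \<open>(x/z)\<^sup>2\<close> blocks, each of which exceeds \<open>z\<close> standard deviations
  with the probability given by the central limit theorem, turns the Gaussian tail at the fixed
  level \<open>z\<close> into a lower bound at the growing level \<open>x\<close>.
\<close>

lemma moderate_deviations_lower:
  fixes x :: "nat \<Rightarrow> real"
  assumes \<delta>: "\<delta> > 0" and \<epsilon>: "\<epsilon> > 0"
    and x_top: "filterlim x at_top sequentially"
    and x_small: "(\<lambda>n. x n / sqrt n) \<longlonglongrightarrow> 0"
  shows "\<forall>\<^sub>F n in sequentially. exp (- (1 + \<delta>) * (x n)\<^sup>2 / 2)
     \<le> prob {\<omega>\<in>space M. (1 - \<epsilon>) * \<sigma> * x n * sqrt n \<le> partial_sum n \<omega>}"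
proof -
  \<comment> \<open>Half of \<open>\<delta>\<close> pays for the Gaussian tail at level z; the other
    half pays in \<open>expo\<close> for rounding up the number of blocks.\<close>
  obtain z where z: "z > 0" and tail: "\<forall>\<^sub>F n in sequentially.
      exp (- (1 + \<delta>/2) * z\<^sup>2 / 2) \<le> prob {\<omega>\<in>space M. z * \<sigma> * sqrt n \<le> partial_sum n \<omega>}"
    using prob_partial_sum_ge_tail[of "\<delta>/2"] \<delta> by auto
  \<comment> \<open>With r blocks of length about n / r, the levels z \<sigma> sqrt (n / r) add up
    to z \<sigma> sqrt (r n), which is at least \<sigma> x sqrt n once r \<ge> (x / z)^2.\<close>
  define r where "r n = nat \<lceil>(x n / z)\<^sup>2\<rceil>" for n
  define l where "l n = n div r n" for n
  have x_pos: "\<forall>\<^sub>F n in sequentially. 0 < x n"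
    using x_top by (simp add: filterlim_at_top_dense)
  have r_lower: "(x n / z)\<^sup>2 \<le> r n" and r_upper: "r n \<le> (x n / z)\<^sup>2 + 1" for n
    using zero_le_power2[of "x n / z"] unfolding r_def by linarith+
  have r_pos: "\<forall>\<^sub>F n in sequentially. 0 < r n"
    using x_pos
  proof eventually_elim
    case (elim n)
    then have "0 < (x n / z)\<^sup>2" using z by simp
    then show ?case using r_lower[of n] by linarith
  qed
  have inv: "(\<lambda>n. 1 / x n) \<longlonglongrightarrow> 0"
    using x_top by (rule real_tendsto_divide_at_top[OF tendsto_const])
  have u: "(\<lambda>n. r n / (x n)\<^sup>2) \<longlonglongrightarrow> 1 / z\<^sup>2"
  proof (rule tendsto_sandwich)
    show "\<forall>\<^sub>F n in sequentially. 1 / z\<^sup>2 \<le> r n / (x n)\<^sup>2"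
      using x_pos by eventually_elim (use r_lower z in \<open>simp add: field_simps\<close>)
    show "\<forall>\<^sub>F n in sequentially. r n / (x n)\<^sup>2 \<le> 1 / z\<^sup>2 + (1 / x n)\<^sup>2"
      using x_pos
    proof eventually_elim
      case (elim n)
      have "r n / (x n)\<^sup>2 \<le> ((x n / z)\<^sup>2 + 1) / (x n)\<^sup>2"
        using r_upper[of n] by (intro divide_right_mono) auto
      also have "\<dots> = 1 / z\<^sup>2 + (1 / x n)\<^sup>2" using elim z by (simp add: field_simps)
      finally show ?case .
    qed
    show "(\<lambda>n. 1 / z\<^sup>2 + (1 / x n)\<^sup>2) \<longlonglongrightarrow> 1 / z\<^sup>2"
      using tendsto_add[OF tendsto_const tendsto_power[OF inv, of 2], of "1 / z\<^sup>2"] by simp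
  qed simp
  have rn: "(\<lambda>n. r n / n) \<longlonglongrightarrow> 0"
  proof -
    have "(\<lambda>n. r n / (x n)\<^sup>2 * (x n / sqrt n)\<^sup>2) \<longlonglongrightarrow> 1 / z\<^sup>2 * 0\<^sup>2"
      by (intro tendsto_intros u x_small)
    moreover have "\<forall>\<^sub>F n in sequentially. r n / (x n)\<^sup>2 * (x n / sqrt n)\<^sup>2 = r n / n"
      using x_pos by eventually_elim (simp add: power_divide)
    ultimately show ?thesis by (simp add: tendsto_cong)
  qed
  have rx: "(\<lambda>n. r n / (x n * sqrt n)) \<longlonglongrightarrow> 0"
  proof -
    have "(\<lambda>n. r n / (x n)\<^sup>2 * (x n / sqrt n)) \<longlonglongrightarrow> 1 / z\<^sup>2 * 0"
      by (intro tendsto_intros u x_small)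
    moreover have "\<forall>\<^sub>F n in sequentially. r n / (x n)\<^sup>2 * (x n / sqrt n) = r n / (x n * sqrt n)"
      using x_pos by eventually_elim (simp add: power2_eq_square)
    ultimately show ?thesis by (simp add: tendsto_cong)
  qed
  have l_top: "filterlim l at_top sequentially"
  proof -
    have "filterlim (\<lambda>n. inverse (r n / n)) at_top sequentially"
    proof (rule filterlim_inverse_at_top[OF rn])
      show "\<forall>\<^sub>F n in sequentially. 0 < r n / n"
        using r_pos eventually_gt_at_top[of 0] by eventually_elim simp
    qed
    then have "\<forall>\<^sub>F n in sequentially. real C \<le> inverse (r n / n)" for C :: nat
      by (simp add: filterlim_at_top)
    note inverse_ge = this
    have "\<forall>\<^sub>F n in sequentially. C \<le> l n" for C
      using inverse_ge[of C] r_pos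
    proof eventually_elim
      case (elim n)
      then have "real C * real (r n) \<le> real n" by (simp add: field_simps)
      then have "C * r n \<le> n" by (metis of_nat_le_iff of_nat_mult)
      then show ?case using elim unfolding l_def by (simp add: less_eq_div_iff_mult_less_eq)
    qed
    then show ?thesis by (simp add: filterlim_at_top)
  qed
  \<comment> \<open>Rounding costs twice: r * l may fall short of n by up to r, and the leftover
    terms, fewer than r, may subtract r * B. Both are negligible because r is of order x^2 and x is
    small against sqrt n.\<close>
  have level: "\<forall>\<^sub>F n in sequentially. (1 - \<epsilon>) * \<sigma> * x n * sqrt n \<le> r n * (z * \<sigma> * sqrt (l n)) - r n * B"
  proof -
    have "(\<lambda>n. sqrt (1 - r n / n) - B / \<sigma> * (r n / (x n * sqrt n))) \<longlonglongrightarrow> sqrt (1 - 0) - B / \<sigma> * 0"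
      by (intro tendsto_intros rn rx)
    then have "\<forall>\<^sub>F n in sequentially. 1 - \<epsilon> < sqrt (1 - r n / n) - B / \<sigma> * (r n / (x n * sqrt n))"
      by (rule order_tendstoD) (use \<epsilon> in simp)
    moreover have "\<forall>\<^sub>F n in sequentially. r n / n < 1"
      using rn by (rule order_tendstoD) simp
    ultimately show ?thesis using x_pos r_pos eventually_gt_at_top[of 0]
    proof eventually_elim
      case (elim n)
      have xn: "0 < x n * sqrt n" using elim by simp
      have "real (r n) * real (l n) = n - n mod r n"
        unfolding l_def by (metis minus_mod_eq_mult_div of_nat_mult)
      also have "\<dots> \<ge> real n - r n" using elim by (simp add: of_nat_diff less_imp_le)
      finally have rl: "real n - r n \<le> real (r n) * l n" .
      have "(1 - \<epsilon>) * \<sigma> * x n * sqrt n = (1 - \<epsilon>) * (\<sigma> * (x n * sqrt n))" by simp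
      also have "\<dots> \<le> (sqrt (1 - r n / n) - B / \<sigma> * (r n / (x n * sqrt n))) * (\<sigma> * (x n * sqrt n))"
        using elim sigma_pos xn by (intro mult_right_mono) auto
      also have "\<dots> = \<sigma> * (x n * (sqrt n * sqrt (1 - r n / n))) - r n * B"
        using xn sigma_pos elim by (simp add: field_simps)
      also have "sqrt n * sqrt (1 - r n / n) = sqrt (real n - r n)"
        using elim by (simp add: real_sqrt_mult[symmetric] field_simps)
      also have "sqrt (real n - r n) \<le> sqrt (real (r n) * l n)" using rl by simp
      also have "x n * sqrt (real (r n) * l n) \<le> z * sqrt (r n) * sqrt (real (r n) * l n)"
      proof -
        have "x n / z \<le> sqrt (r n)"
          by (rule real_le_rsqrt) (rule r_lower)
        then show ?thesis using z by (intro mult_right_mono) (auto simp: field_simps)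
      qed
      also have "z * sqrt (r n) * sqrt (real (r n) * l n) = r n * (z * sqrt (l n))"
        by (simp add: real_sqrt_mult)
      finally show ?case using elim sigma_pos by (simp add: algebra_simps)
    qed
  qed
  have "\<forall>\<^sub>F n in sequentially. (1 + \<delta>/2) * z\<^sup>2 / (\<delta>/2) < x n" "\<forall>\<^sub>F n in sequentially. 1 < x n"
    using x_top by (simp_all add: filterlim_at_top_dense)
  then have expo: "\<forall>\<^sub>F n in sequentially. (1 + \<delta>/2) * z\<^sup>2 * r n \<le> (1 + \<delta>) * (x n)\<^sup>2"
  proof eventually_elim
    case (elim n)
    have "(1 + \<delta>/2) * z\<^sup>2 * r n \<le> (1 + \<delta>/2) * z\<^sup>2 * ((x n / z)\<^sup>2 + 1)"
      using r_upper[of n] \<delta> by (intro mult_left_mono) auto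
    also have "\<dots> = (1 + \<delta>/2) * (x n)\<^sup>2 + (1 + \<delta>/2) * z\<^sup>2"
      using z by (simp add: field_simps)
    also have "(1 + \<delta>/2) * z\<^sup>2 \<le> \<delta>/2 * x n" using elim(1) \<delta> by (simp add: field_simps)
    also have "\<dots> \<le> \<delta>/2 * (x n)\<^sup>2"
      using elim(2) \<delta> by (intro mult_left_mono) (auto simp: power2_eq_square)
    finally show ?case by (simp add: algebra_simps)
  qed
  have "\<forall>\<^sub>F n in sequentially. exp (- (1 + \<delta>/2) * z\<^sup>2 / 2)
      \<le> prob {\<omega>\<in>space M. z * \<sigma> * sqrt (l n) \<le> partial_sum (l n) \<omega>}"
    using tail l_top by (rule eventually_compose_filterlim)
  then show ?thesis using level expo r_pos
  proof eventually_elim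
    case (elim n)
    have "exp (- (1 + \<delta>) * (x n)\<^sup>2 / 2) \<le> exp (- ((1 + \<delta>/2) * z\<^sup>2 * r n) / 2)"
    proof -
      have "- (1 + \<delta>) * (x n)\<^sup>2 = - ((1 + \<delta>) * (x n)\<^sup>2)" by (simp only: mult_minus_left)
      then show ?thesis using elim(3) by simp
    qed
    also have "\<dots> = exp (- (1 + \<delta>/2) * z\<^sup>2 / 2) ^ r n"
      unfolding exp_of_nat_mult[symmetric] by (simp add: field_simps)
    also have "\<dots> \<le> prob {\<omega>\<in>space M. z * \<sigma> * sqrt (l n) \<le> partial_sum (l n) \<omega>} ^ r n"
      using elim(1) by (intro power_mono) auto
    also have "\<dots> \<le> prob {\<omega>\<in>space M. r n * (z * \<sigma> * sqrt (l n)) \<le> partial_sum (r n * l n) \<omega>}"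
      by (rule prob_partial_sum_power)
    also have "\<dots> \<le> prob {\<omega>\<in>space M. (1 - \<epsilon>) * \<sigma> * x n * sqrt n \<le> partial_sum n \<omega>}"
    proof (rule finite_measure_mono)
      show "{\<omega>\<in>space M. r n * (z * \<sigma> * sqrt (l n)) \<le> partial_sum (r n * l n) \<omega>}
          \<subseteq> {\<omega>\<in>space M. (1 - \<epsilon>) * \<sigma> * x n * sqrt n \<le> partial_sum n \<omega>}"
      proof safe
        fix \<omega> assume \<omega>: "\<omega> \<in> space M" and ge: "r n * (z * \<sigma> * sqrt (l n)) \<le> partial_sum (r n * l n) \<omega>"
        let ?b = "n mod r n"
        have n_eq: "n = r n * l n + ?b" unfolding l_def by simp
        have "partial_sum n \<omega> = partial_sum (r n * l n) \<omega> + (\<Sum>i\<in>{r n * l n..<r n * l n + ?b}. Y i \<omega>)"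
          using partial_sum_add[of "r n * l n" ?b \<omega>] n_eq by simp
        moreover have "\<bar>\<Sum>i\<in>{r n * l n..<r n * l n + ?b}. Y i \<omega>\<bar> \<le> r n * B"
        proof -
          have "\<bar>\<Sum>i\<in>{r n * l n..<r n * l n + ?b}. Y i \<omega>\<bar> \<le> (\<Sum>i\<in>{r n * l n..<r n * l n + ?b}. \<bar>Y i \<omega>\<bar>)"
            by (rule sum_abs)
          also have "\<dots> \<le> (\<Sum>i\<in>{r n * l n..<r n * l n + ?b}. B)"
            by (intro sum_mono bounded \<omega>)
          also have "\<dots> \<le> r n * B"
            using elim B_nonneg by (auto intro!: mult_right_mono simp: less_imp_le)
          finally show ?thesis .
        qed
        ultimately show "(1 - \<epsilon>) * \<sigma> * x n * sqrt n \<le> partial_sum n \<omega>"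
          using ge elim(2) by linarith
      qed
    qed simp
    finally show ?case .
  qed
qed

text \<open>Independent blocks between consecutive powers of q exceed their level infinitely often
  by the second Borel-Cantelli lemma, and the sum before each block cannot undo this.\<close>

theorem LIL_lower:
  assumes c: "0 < c" "c < 1"
  shows "AE \<omega> in M. \<exists>\<^sub>F n in sequentially. c * \<sigma> * sqrt (2 * (n * ln (ln n))) \<le> partial_sum n \<omega>"
proof -
  define d where "d = (1 + c) / 2"
  have d: "c < d" "0 < d" "d < 1" using c by (auto simp: d_def)
  obtain q :: nat where q: "2 \<le> q" and qev: "\<forall>\<^sub>F k in sequentially. c * sqrt (2 * (real q ^ Suc k * ln (ln (real q ^ Suc k))))
       \<le> d * sqrt (2 * ((real q ^ Suc k - real q ^ k) * ln (ln (real q ^ Suc k - real q ^ k)))) - 2 * sqrt (2 * (real q ^ k * ln (ln (real q ^ k))))"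
    using sparse_subsequence_factor[OF c(1) d(1)] by blast
  define N where "N k = q ^ Suc k - q ^ k" for k
  have le_pow: "q ^ k \<le> q ^ Suc k" for k using q by simp
  have N_real: "real (N k) = real q ^ Suc k - real q ^ k" for k
    unfolding N_def using le_pow[of k] by (simp add: of_nat_diff)
  have N_ge: "2 ^ k \<le> N k" for k
  proof -
    have "2 ^ k \<le> q ^ k" using q by (intro power_mono) auto
    also have "q ^ k \<le> N k" using q unfolding N_def by (cases q) (auto simp: algebra_simps)
    finally show ?thesis .
  qed
  have N_top: "filterlim N at_top sequentially"
  proof (rule filterlim_at_top_mono)
    show "filterlim (\<lambda>k. k) at_top sequentially" by (rule filterlim_ident)
    show "\<forall>\<^sub>F k in sequentially. k \<le> N k"
      using N_ge less_exp[of _] by (intro always_eventually allI) (meson less_imp_le_nat order_trans)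
  qed
  \<comment> \<open>With \<epsilon> = 1 - sqrt d and \<delta> = 1 / d - 1 the level becomes d sqrt
    (2 ln ln n) standard deviations and the exponent exactly - ln ln n, so the probability is at
    least 1 / ln n.\<close>
  let ?x = "\<lambda>n::nat. sqrt d * sqrt (2 * ln (ln n))"
  have md: "\<forall>\<^sub>F n in sequentially. exp (- (1 + (1 / d - 1)) * (?x n)\<^sup>2 / 2)
     \<le> prob {\<omega>\<in>space M. (1 - (1 - sqrt d)) * \<sigma> * ?x n * sqrt n \<le> partial_sum n \<omega>}"
  proof (rule moderate_deviations_lower)
    show "filterlim ?x at_top sequentially" using d by real_asymp
    show "(\<lambda>n. ?x n / sqrt n) \<longlonglongrightarrow> 0" using d by real_asymp
  qed (use d in \<open>auto simp: field_simps\<close>)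
  moreover have "\<forall>\<^sub>F n::nat in sequentially. 0 < ln (ln (real n))" "\<forall>\<^sub>F n::nat in sequentially. 0 < ln (real n)"
    by real_asymp+
  ultimately have "\<forall>\<^sub>F n in sequentially. 1 / ln n
     \<le> prob {\<omega>\<in>space M. d * \<sigma> * sqrt (2 * (n * ln (ln n))) \<le> partial_sum n \<omega>}"
  proof eventually_elim
    case (elim n)
    have "(?x n)\<^sup>2 = 2 * (d * ln (ln n))" using elim d by (simp add: power_mult_distrib)
    then have "- (1 + (1 / d - 1)) * (?x n)\<^sup>2 / 2 = - ln (ln n)" using d by simp
    then have exp_eq: "exp (- (1 + (1 / d - 1)) * (?x n)\<^sup>2 / 2) = 1 / ln n"
      using elim by (simp add: exp_minus inverse_eq_divide)
    have "(1 - (1 - sqrt d)) * \<sigma> * ?x n * sqrt n = (sqrt d * sqrt d) * \<sigma> * sqrt (2 * (n * ln (ln n)))"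
      by (simp add: real_sqrt_mult)
    also have "sqrt d * sqrt d = d" using d by simp
    finally have level_eq: "(1 - (1 - sqrt d)) * \<sigma> * ?x n * sqrt n = d * \<sigma> * sqrt (2 * (n * ln (ln n)))" .
    show ?case using elim(1) unfolding exp_eq level_eq .
  qed
  then have evN: "\<forall>\<^sub>F k in sequentially. 1 / ln (N k)
     \<le> prob {\<omega>\<in>space M. d * \<sigma> * sqrt (2 * (N k * ln (ln (N k)))) \<le> partial_sum (N k) \<omega>}"
    using N_top by (rule eventually_compose_filterlim)
  define T where "T k \<omega> = (\<Sum>i\<in>{q ^ k..<q ^ Suc k}. Y i \<omega>)" for k \<omega>
  have T_eq: "partial_sum (q ^ Suc k) \<omega> = partial_sum (q ^ k) \<omega> + T k \<omega>" for k \<omega>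
    using partial_sum_add[of "q ^ k" "N k" \<omega>] le_pow[of k] by (simp add: T_def N_def)
  define E where "E k = {\<omega>\<in>space M. d * \<sigma> * sqrt (2 * (N k * ln (ln (N k)))) \<le> T k \<omega>}" for k
  have prob_E: "prob (E k) = prob {\<omega>\<in>space M. d * \<sigma> * sqrt (2 * (N k * ln (ln (N k)))) \<le> partial_sum (N k) \<omega>}" for k
    using prob_block[of "\<lambda>y. d * \<sigma> * sqrt (2 * (N k * ln (ln (N k)))) \<le> y" "q ^ k" "N k"] le_pow[of k]
    by (simp add: E_def T_def N_def)
  have disj: "disjoint_family (\<lambda>k. {q ^ k..<q ^ Suc k})"
  proof (unfold disjoint_family_on_def, intro ballI impI)
    have *: "{q ^ i..<q ^ Suc i} \<inter> {q ^ j..<q ^ Suc j} = {}" if "i < j" for i j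
    proof -
      have "q ^ Suc i \<le> q ^ j" using that q by (intro power_increasing) auto
      then show ?thesis by auto
    qed
    show "{q ^ i..<q ^ Suc i} \<inter> {q ^ j..<q ^ Suc j} = {}" if "i \<noteq> j" for i j
      using *[of i j] *[of j i] that by (cases "i < j") auto
  qed
  have "indep_vars (\<lambda>k. PiM {q ^ k..<q ^ Suc k} (\<lambda>_. borel)) (\<lambda>k \<omega>. restrict (\<lambda>i. Y i \<omega>) {q ^ k..<q ^ Suc k}) UNIV"
    by (rule indep_vars_restrict[OF indep _ disj]) auto
  then have "indep_vars (\<lambda>_. borel) (\<lambda>k \<omega>. \<Sum>i\<in>{q ^ k..<q ^ Suc k}. restrict (\<lambda>i. Y i \<omega>) {q ^ k..<q ^ Suc k} i) UNIV"
    by (rule indep_vars_compose2) (intro borel_measurable_sum measurable_component_singleton)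
  moreover have "(\<lambda>k \<omega>. \<Sum>i\<in>{q ^ k..<q ^ Suc k}. restrict (\<lambda>i. Y i \<omega>) {q ^ k..<q ^ Suc k} i) = T"
    unfolding T_def[abs_def] by (intro ext sum.cong) auto
  ultimately have "indep_vars (\<lambda>_. borel) T UNIV" by simp
  then have indE: "indep_events E UNIV"
    unfolding E_def by (rule indep_eventsI_indep_vars) simp
  \<comment> \<open>Since ln (N k) \<le> (k + 1) ln q, the bound 1 / ln (N k) dominates a multiple
    of the harmonic series.\<close>
  have "\<not> summable (\<lambda>k. prob (E k))"
  proof
    assume sm: "summable (\<lambda>k. prob (E k))"
    have "summable (\<lambda>k. 1 / ln q * (1 / real (Suc k)))"
    proof (rule summable_comparison_test_ev[OF _ sm])
      show "\<forall>\<^sub>F k in sequentially. norm (1 / ln q * (1 / real (Suc k))) \<le> prob (E k)"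
        using evN eventually_gt_at_top[of 0]
      proof eventually_elim
        case (elim k)
        have "1 < (2::nat) ^ k" using elim by (intro one_less_power) auto
        then have N1: "1 < real (N k)" using N_ge[of k] by linarith
        have "real (N k) \<le> real q ^ Suc k" using N_real[of k] by simp
        then have "ln (N k) \<le> real (Suc k) * ln q"
          using N1 q ln_mono[of "real (N k)" "real q ^ Suc k"] by (simp add: ln_realpow del: power_Suc)
        moreover have "0 < ln (real (N k))" using N1 by simp
        moreover have "0 < ln (real q)" using q by simp
        ultimately have "1 / (real (Suc k) * ln q) \<le> 1 / ln (N k)"
          by (intro divide_left_mono) auto
        then show ?case using elim(1) q by (simp add: prob_E mult.commute)
      qed
    qed
    then have "summable (\<lambda>k. 1 / real (Suc k))"
      using q by (subst (asm) summable_cmult_iff) auto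
    then have "summable (\<lambda>k. inverse (real k))"
      using summable_Suc_iff[of "\<lambda>k. inverse (real k)"] by (simp add: inverse_eq_divide)
    then show False using not_summable_harmonic by blast
  qed
  then have io: "AE \<omega> in M. \<exists>\<^sub>F k in sequentially. \<omega> \<in> E k"
    by (rule borel_cantelli2[OF indE])
  interpret neg: bounded_centred_iid M "\<lambda>i \<omega>. - Y i \<omega>" B \<sigma>
    by (rule bounded_centred_iid_uminus)
  have "AE \<omega> in M. \<forall>\<^sub>F n in sequentially. neg.partial_sum n \<omega> \<le> 2 * \<sigma> * sqrt (2 * (n * ln (ln n)))"
    by (rule neg.LIL_upper) simp
  with io show ?thesis
  proof eventually_elim
    case (elim \<omega>)
    have pow_top: "filterlim (\<lambda>k. q ^ k) at_top sequentially"
    proof (rule filterlim_at_top_mono)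
      show "filterlim (\<lambda>k. k) at_top sequentially" by (rule filterlim_ident)
      show "\<forall>\<^sub>F k in sequentially. k \<le> q ^ k"
      proof (intro always_eventually allI)
        fix k have "k < 2 ^ k" by (rule less_exp)
        also have "2 ^ k \<le> q ^ k" using q by (intro power_mono) auto
        finally show "k \<le> q ^ k" by simp
      qed
    qed
    have "\<forall>\<^sub>F k in sequentially. - partial_sum (q ^ k) \<omega> \<le> 2 * \<sigma> * sqrt (2 * (real q ^ k * ln (ln (real q ^ k))))"
      using eventually_compose_filterlim[OF elim(2) pow_top]
      by (simp add: neg.partial_sum_def partial_sum_def sum_negf)
    then have "\<exists>\<^sub>F k in sequentially. \<omega> \<in> E k \<and> - partial_sum (q ^ k) \<omega> \<le> 2 * \<sigma> * sqrt (2 * (real q ^ k * ln (ln (real q ^ k)))) \<and>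
      c * sqrt (2 * (real q ^ Suc k * ln (ln (real q ^ Suc k))))
       \<le> d * sqrt (2 * ((real q ^ Suc k - real q ^ k) * ln (ln (real q ^ Suc k - real q ^ k)))) - 2 * sqrt (2 * (real q ^ k * ln (ln (real q ^ k))))"
      using elim(1) qev by (intro frequently_eventually_frequently eventually_conj)
    then have fr: "\<exists>\<^sub>F k in sequentially. c * \<sigma> * sqrt (2 * (real (q ^ Suc k) * ln (ln (real (q ^ Suc k))))) \<le> partial_sum (q ^ Suc k) \<omega>"
    proof (rule frequently_elim1)
      fix k assume H: "\<omega> \<in> E k \<and> - partial_sum (q ^ k) \<omega> \<le> 2 * \<sigma> * sqrt (2 * (real q ^ k * ln (ln (real q ^ k)))) \<and>
      c * sqrt (2 * (real q ^ Suc k * ln (ln (real q ^ Suc k))))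
       \<le> d * sqrt (2 * ((real q ^ Suc k - real q ^ k) * ln (ln (real q ^ Suc k - real q ^ k)))) - 2 * sqrt (2 * (real q ^ k * ln (ln (real q ^ k))))"
      have "\<sigma> * (c * sqrt (2 * (real q ^ Suc k * ln (ln (real q ^ Suc k)))))
          \<le> \<sigma> * (d * sqrt (2 * ((real q ^ Suc k - real q ^ k) * ln (ln (real q ^ Suc k - real q ^ k)))) - 2 * sqrt (2 * (real q ^ k * ln (ln (real q ^ k)))))"
        using H sigma_pos by (intro mult_left_mono) auto
      also have "\<dots> = d * \<sigma> * sqrt (2 * (N k * ln (ln (N k)))) - 2 * \<sigma> * sqrt (2 * (real q ^ k * ln (ln (real q ^ k))))"
        unfolding N_real by (simp add: algebra_simps)
      also have "\<dots> \<le> T k \<omega> + partial_sum (q ^ k) \<omega>"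
        using H unfolding E_def by simp
      also have "\<dots> = partial_sum (q ^ Suc k) \<omega>" by (simp only: T_eq add.commute)
      finally show "c * \<sigma> * sqrt (2 * (real (q ^ Suc k) * ln (ln (real (q ^ Suc k))))) \<le> partial_sum (q ^ Suc k) \<omega>"
        by (simp add: mult_ac)
    qed
    \<comment> \<open>An eventual failure in n would pull back along q^(k+1) to an eventual failure
      in k, against \<open>fr\<close>.\<close>
    have "filterlim (\<lambda>k. q ^ Suc k) at_top sequentially"
      using pow_top by (subst filterlim_sequentially_Suc)
    then show ?case using fr
      unfolding frequently_def
      using eventually_compose_filterlim by blast
  qed
qed

theorem LIL:
  "AE \<omega> in M. limsup (\<lambda>n. ereal (partial_sum n \<omega> / sqrt (n * ln (ln n)))) = ereal (sqrt 2 * \<sigma>)"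
proof -
  have "AE \<omega> in M. \<forall>j. \<forall>\<^sub>F n in sequentially. partial_sum n \<omega> \<le> (1 + 1 / real (Suc j)) * \<sigma> * sqrt (2 * (n * ln (ln n)))"
    unfolding AE_all_countable by (intro allI LIL_upper) simp
  \<comment> \<open>The double \<open>Suc\<close> keeps the constant strictly positive at j = 0, as
    \<open>LIL_lower\<close> demands.\<close>
  moreover have "AE \<omega> in M. \<forall>j. \<exists>\<^sub>F n in sequentially. (1 - 1 / real (Suc (Suc j))) * \<sigma> * sqrt (2 * (n * ln (ln n))) \<le> partial_sum n \<omega>"
    unfolding AE_all_countable by (intro allI LIL_lower) auto
  ultimately show ?thesis
  proof eventually_elim
    case (elim \<omega>)
    let ?u = "\<lambda>n. partial_sum n \<omega> / sqrt (n * ln (ln n))"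
    have "\<forall>\<^sub>F n::nat in sequentially. 0 < n * ln (ln n)" by real_asymp
    then have pos: "\<forall>\<^sub>F n::nat in sequentially. 0 < sqrt (n * ln (ln n))"
      by eventually_elim simp
    have eq: "a * \<sigma> * sqrt (2 * (n * ln (ln n))) = a * (sqrt 2 * \<sigma>) * sqrt (n * ln (ln n))" for a and n :: nat
      by (simp add: real_sqrt_mult)
    have upper: "limsup (\<lambda>n. ereal (?u n)) \<le> ereal ((1 + 1 / real (Suc j)) * (sqrt 2 * \<sigma>))" for j
    proof (rule Limsup_bounded)
      show "\<forall>\<^sub>F n in sequentially. ereal (?u n) \<le> ereal ((1 + 1 / real (Suc j)) * (sqrt 2 * \<sigma>))"
        using elim(1)[rule_format, of j] pos
        unfolding eq by eventually_elim (simp only: ereal_less_eq(3) pos_divide_le_eq)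
    qed
    have lim_upper: "(\<lambda>j. ereal ((1 + 1 / real (Suc j)) * (sqrt 2 * \<sigma>))) \<longlonglongrightarrow> ereal (sqrt 2 * \<sigma>)"
    proof -
      have "(\<lambda>j. (1 + 1 / real (Suc j)) * (sqrt 2 * \<sigma>)) \<longlonglongrightarrow> (1 + 0) * (sqrt 2 * \<sigma>)"
        by (intro tendsto_intros LIMSEQ_Suc[OF lim_1_over_n])
      then show ?thesis by simp
    qed
    have le: "limsup (\<lambda>n. ereal (?u n)) \<le> ereal (sqrt 2 * \<sigma>)"
      by (rule LIMSEQ_le_const[OF lim_upper]) (use upper in blast)
    have lower: "ereal ((1 - 1 / real (Suc (Suc j))) * (sqrt 2 * \<sigma>)) \<le> limsup (\<lambda>n. ereal (?u n))" for j
    proof (rule ccontr)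
      assume "\<not> ?thesis"
      then have "limsup (\<lambda>n. ereal (?u n)) < ereal ((1 - 1 / real (Suc (Suc j))) * (sqrt 2 * \<sigma>))" by simp
      then have "\<forall>\<^sub>F n in sequentially. ereal (?u n) < ereal ((1 - 1 / real (Suc (Suc j))) * (sqrt 2 * \<sigma>))"
        by (rule Limsup_lessD)
      then have "\<forall>\<^sub>F n in sequentially. \<not> (1 - 1 / real (Suc (Suc j))) * \<sigma> * sqrt (2 * (n * ln (ln n))) \<le> partial_sum n \<omega>"
        unfolding eq using pos by eventually_elim (simp only: ereal_less(1) less_ereal.simps(1) pos_divide_less_eq not_le)
      with elim(2)[rule_format, of j] show False unfolding frequently_def by blast
    qed
    have lim_lower: "(\<lambda>j. ereal ((1 - 1 / real (Suc (Suc j))) * (sqrt 2 * \<sigma>))) \<longlonglongrightarrow> ereal (sqrt 2 * \<sigma>)"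
    proof -
      have "(\<lambda>j. (1 - 1 / real (Suc (Suc j))) * (sqrt 2 * \<sigma>)) \<longlonglongrightarrow> (1 - 0) * (sqrt 2 * \<sigma>)"
        by (intro tendsto_intros LIMSEQ_Suc[OF LIMSEQ_Suc[OF lim_1_over_n]])
      then show ?thesis by simp
    qed
    have "ereal (sqrt 2 * \<sigma>) \<le> limsup (\<lambda>n. ereal (?u n))"
      by (rule LIMSEQ_le_const2[OF lim_lower]) (use lower in blast)
    with le show ?case by (rule antisym)
  qed
qed

end

section \<open>Consistency and linearisation of the minimiser\<close>

text \<open>Hoeffding's inequality makes the deviation probabilities geometrically small, so the
  first Borel-Cantelli lemma suffices.\<close>

lemma (in iid_sequence) SLLN_bounded:
  fixes g :: "real \<Rightarrow> real"
  assumes g [measurable]: "g \<in> borel_measurable borel" and bounded: "\<And>y. \<bar>g y\<bar> \<le> C"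
  shows "AE \<omega> in M. (\<lambda>n. (\<Sum>i<n. g (Y i \<omega>)) / n) \<longlonglongrightarrow> expectation (\<lambda>\<omega>. g (Y 0 \<omega>))"
proof -
  let ?\<mu> = "expectation (\<lambda>\<omega>. g (Y 0 \<omega>))" and ?S = "\<lambda>n \<omega>. (\<Sum>i<n. g (Y i \<omega>)) / real n"
  \<comment> \<open>The extra 1 keeps the range [-D, D] nondegenerate even when C = 0.\<close>
  define D where "D = C + 1"
  have D: "0 < D" "\<bar>g y\<bar> \<le> D" for y
    using bounded[of y] by (simp_all add: D_def)
  have ev: "AE \<omega> in M. \<forall>\<^sub>F n in sequentially. \<bar>?S n \<omega> - ?\<mu>\<bar> < e" if e: "0 < e" for e
  proof -
    define E where "E n = {\<omega>\<in>space M. e \<le> \<bar>?S n \<omega> - ?\<mu>\<bar>}" for n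
    have [measurable]: "E n \<in> events" for n unfolding E_def by measurable
    define q where "q = exp (- 2 * e\<^sup>2 / (D - - D)\<^sup>2)"
    have q: "0 \<le> q" "q < 1" using e D by (auto simp: q_def)
    have le: "prob (E n) \<le> 2 * q ^ n" if "0 < n" for n
    proof -
      interpret H: Hoeffding_ineq_iid M "{..<n}" "\<lambda>i \<omega>. g (Y i \<omega>)" "\<lambda>\<omega>. g (Y 0 \<omega>)" "- D" D ?\<mu>
      proof unfold_locales
        show "indep_vars (\<lambda>_. borel) (\<lambda>i \<omega>. g (Y i \<omega>)) {..<n}"
          by (rule indep_vars_compose2[OF indep_vars_subset[OF indep]]) auto
        have "distr M borel (\<lambda>\<omega>. g (Y i \<omega>)) = distr (distr M borel (Y i)) borel g" for i
          by (subst distr_distr) (auto simp: comp_def)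
        then show "distr M borel (\<lambda>\<omega>. g (Y i \<omega>)) = distr M borel (\<lambda>\<omega>. g (Y 0 \<omega>))" for i
          using distr_eq[of i] by simp
        show "AE x in M. g (Y 0 x) \<in> {- D..D}"
          by (rule AE_I2) (use D(2) in \<open>auto simp: abs_le_iff minus_le_iff\<close>)
      qed auto
      have "prob {x\<in>space M. e \<le> \<bar>(\<Sum>i<n. g (Y i x)) / real (card {..<n}) - ?\<mu>\<bar>}
          \<le> 2 * exp (- 2 * real (card {..<n}) * e\<^sup>2 / (D - - D)\<^sup>2)"
        by (rule H.Hoeffding_ineq_abs_ge') (use e D(1) that in \<open>auto simp: lessThan_empty_iff\<close>)
      then have "prob (E n) \<le> 2 * exp (- 2 * real n * e\<^sup>2 / (D - - D)\<^sup>2)"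
        unfolding E_def card_lessThan .
      also have "exp (- 2 * real n * e\<^sup>2 / (D - - D)\<^sup>2) = q ^ n"
        unfolding q_def exp_of_nat_mult[symmetric] by simp
      finally show ?thesis .
    qed
    have "summable (\<lambda>n. prob (E n))"
    proof (rule summable_comparison_test_ev)
      show "\<forall>\<^sub>F n in sequentially. norm (prob (E n)) \<le> 2 * q ^ n"
        using eventually_gt_at_top[of 0] by eventually_elim (use le in simp)
      show "summable (\<lambda>n. 2 * q ^ n)" using q by (intro summable_mult summable_geometric) simp
    qed
    then have "AE \<omega> in M. \<forall>\<^sub>F n in sequentially. \<omega> \<in> space M - E n"
      by (intro borel_cantelli_AE1) (auto simp: emeasure_eq_measure)
    then show ?thesis
      by eventually_elim (auto elim!: eventually_mono simp: E_def)
  qed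
  have "AE \<omega> in M. \<forall>j. \<forall>\<^sub>F n in sequentially. \<bar>?S n \<omega> - ?\<mu>\<bar> < 1 / real (Suc j)"
    unfolding AE_all_countable by (intro allI ev) simp
  then show ?thesis
  proof eventually_elim
    case (elim \<omega>)
    show ?case
    proof (rule tendstoI)
      fix e :: real assume "0 < e"
      then obtain j where "1 / real (Suc j) < e" using nat_approx_posE by blast
      then show "\<forall>\<^sub>F n in sequentially. dist (?S n \<omega>) ?\<mu> < e"
        using elim[rule_format, of j] by (auto elim!: eventually_mono simp: dist_real_def)
    qed
  qed
qed

section \<open>The score and the contrast of a single observation\<close>

definition score :: "real \<Rightarrow> real" where
  "score u = 2 * u / (1 + u\<^sup>2)"

text \<open>Written as a polynomial in 1 / (1 + u^2), so that its mean reduces to two inverse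
  moments and its Lipschitz bound to that of 1 / (1 + u^2).\<close>

definition score_deriv :: "real \<Rightarrow> real" where
  "score_deriv u = 4 * (1 / (1 + u\<^sup>2))\<^sup>2 - 2 * (1 / (1 + u\<^sup>2))"

lemma one_plus_square_pos [simp]: "0 < 1 + (u::real)\<^sup>2"
  by (simp add: add_pos_nonneg)

lemma one_plus_square_neq_0 [simp]: "1 + (u::real)\<^sup>2 \<noteq> 0"
  using one_plus_square_pos[of u] by linarith

lemma abs_le_one_plus_square: "2 * \<bar>u\<bar> \<le> 1 + (u::real)\<^sup>2"
  using zero_le_power2[of "\<bar>u\<bar> - 1"] by (simp add: power2_diff)

lemma score_measurable [measurable]: "score \<in> borel_measurable borel"
  unfolding score_def[abs_def] by measurable

lemma score_deriv_measurable [measurable]: "score_deriv \<in> borel_measurable borel"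
  unfolding score_deriv_def[abs_def] by measurable

lemma abs_score_le: "\<bar>score u\<bar> \<le> 1"
  using abs_le_one_plus_square[of u] by (simp add: score_def abs_mult divide_le_eq)

lemma has_derivative_ln_one_plus_square:
  "((\<lambda>u. ln (1 + u\<^sup>2)) has_field_derivative score u) (at u within S)"
  by (auto intro!: derivative_eq_intros simp: score_def)

lemma has_derivative_score: "(score has_field_derivative score_deriv u) (at u within S)"
proof -
  have "score_deriv u = (2 * (1 + u\<^sup>2) - 2 * u * (2 * u)) / ((1 + u\<^sup>2) * (1 + u\<^sup>2))"
    unfolding score_deriv_def by (simp add: divide_simps) (simp add: power2_eq_square algebra_simps)
  then show ?thesis
    unfolding score_def[abs_def] by (auto intro!: derivative_eq_intros simp: algebra_simps)
qed

lemma ln_one_plus_square_lipschitz: "\<bar>ln (1 + u\<^sup>2) - ln (1 + v\<^sup>2)\<bar> \<le> \<bar>u - v :: real\<bar>"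
  using field_differentiable_bound[of UNIV "\<lambda>u::real. ln (1 + u\<^sup>2)" score 1 u v]
    has_derivative_ln_one_plus_square abs_score_le by simp

lemma score_deriv_lipschitz: "\<bar>score_deriv u - score_deriv v\<bar> \<le> 10 * \<bar>u - v\<bar>"
proof -
  define h where "h w = 1 / (1 + w\<^sup>2)" for w :: real
  have h01: "0 \<le> h w" "h w \<le> 1" for w by (auto simp: h_def divide_le_eq)
  have lip: "\<bar>h u - h v\<bar> \<le> \<bar>u - v\<bar>"
  proof -
    have "h u - h v = (v - u) * (u + v) * (h u * h v)"
      by (simp add: h_def field_simps) (simp add: power2_eq_square algebra_simps)
    then have "\<bar>h u - h v\<bar> = \<bar>u - v\<bar> * (\<bar>u + v\<bar> * (h u * h v))"
      using h01 by (simp add: abs_mult abs_minus_commute)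
    moreover have "\<bar>u + v\<bar> * (h u * h v) \<le> 1"
    proof -
      have "\<bar>u + v\<bar> \<le> ((1 + u\<^sup>2) + (1 + v\<^sup>2)) / 2"
        using abs_le_one_plus_square[of u] abs_le_one_plus_square[of v] abs_triangle_ineq[of u v]
        by (simp add: field_simps)
      also have "\<dots> \<le> (1 + u\<^sup>2) * (1 + v\<^sup>2)"
        by (simp add: field_simps add_nonneg_nonneg)
      finally show ?thesis by (simp add: h_def divide_le_eq)
    qed
    ultimately show ?thesis using mult_left_le[of "\<bar>u + v\<bar> * (h u * h v)" "\<bar>u - v\<bar>"] by simp
  qed
  have "score_deriv u - score_deriv v = (h u - h v) * (4 * (h u + h v) - 2)"
    unfolding score_deriv_def h_def[symmetric] by (simp add: power2_eq_square algebra_simps)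
  then have "\<bar>score_deriv u - score_deriv v\<bar> = \<bar>h u - h v\<bar> * \<bar>4 * (h u + h v) - 2\<bar>"
    by (simp add: abs_mult)
  \<comment> \<open>As h has values in [0, 1], the second factor lies in [-2, 6]; 10 is a generous
    bound.\<close>
  also have "\<dots> \<le> \<bar>u - v\<bar> * 10"
    using lip h01[of u] h01[of v] by (intro mult_mono) auto
  finally show ?thesis by simp
qed

lemma abs_score_deriv_le: "\<bar>score_deriv u\<bar> \<le> 6"
proof -
  define h where "h = 1 / (1 + u\<^sup>2)"
  have h: "0 \<le> h" "h \<le> 1" by (auto simp: h_def divide_le_eq)
  then have "0 \<le> h\<^sup>2" "h\<^sup>2 \<le> 1" by (auto simp: power_le_one)
  with h have "\<bar>4 * h\<^sup>2 - 2 * h\<bar> \<le> 6" by linarith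
  then show ?thesis by (simp add: score_deriv_def h_def)
qed

definition excess :: "real \<Rightarrow> real \<Rightarrow> real" where
  "excess t x = ln (1 + (x - t)\<^sup>2) - ln (1 + x\<^sup>2)"

lemma excess_measurable [measurable]: "excess t \<in> borel_measurable borel"
  unfolding excess_def[abs_def] by measurable

lemma excess_lipschitz: "\<bar>excess s x - excess t x\<bar> \<le> \<bar>s - t\<bar>"
  using ln_one_plus_square_lipschitz[of "x - s" "x - t"] by (simp add: excess_def abs_minus_commute)

lemma abs_excess_le: "\<bar>excess t x\<bar> \<le> \<bar>t\<bar>"
  using excess_lipschitz[of t x 0] by (simp add: excess_def)

text \<open>Uniform in x and only logarithmic in t. The Lipschitz bound -|t| would swamp the gain of
  order 2 ln |t| that the central observations provide.\<close>

lemma excess_lower: "- (ln 2 + ln (1 + t\<^sup>2)) \<le> excess t x"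
proof -
  have "1 + x\<^sup>2 \<le> 2 * (1 + t\<^sup>2) * (1 + (x - t)\<^sup>2)"
  proof -
    have "2 * (1 + t\<^sup>2) * (1 + (x - t)\<^sup>2) - (1 + x\<^sup>2) = 1 + (x - 2 * t)\<^sup>2 + 2 * (t * (x - t))\<^sup>2"
      by (simp add: power2_eq_square algebra_simps)
    also have "\<dots> \<ge> 0" by simp
    finally show ?thesis by simp
  qed
  then have "ln (1 + x\<^sup>2) \<le> ln (2 * (1 + t\<^sup>2) * (1 + (x - t)\<^sup>2))"
    by (rule ln_mono) simp
  also have "\<dots> = ln 2 + ln (1 + t\<^sup>2) + ln (1 + (x - t)\<^sup>2)"
    using ln_mult_pos[of 2 "1 + t\<^sup>2"] ln_mult_pos[of "2 * (1 + t\<^sup>2)" "1 + (x - t)\<^sup>2"]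
    by (simp only: one_plus_square_pos zero_less_mult_iff zero_less_numeral simp_thms)
  finally show ?thesis by (simp add: excess_def)
qed

lemma excess_lower_near:
  assumes "\<bar>x\<bar> \<le> K" "K \<le> \<bar>t\<bar>"
  shows "ln (1 + (\<bar>t\<bar> - K)\<^sup>2) - ln (1 + K\<^sup>2) \<le> excess t x"
proof -
  have "(\<bar>t\<bar> - K)\<^sup>2 \<le> (x - t)\<^sup>2" using assms by (intro abs_le_square_iff[THEN iffD1]) linarith
  moreover have "x\<^sup>2 \<le> K\<^sup>2" using assms by (simp add: abs_le_square_iff[symmetric])
  ultimately have "ln (1 + (\<bar>t\<bar> - K)\<^sup>2) \<le> ln (1 + (x - t)\<^sup>2)" "ln (1 + x\<^sup>2) \<le> ln (1 + K\<^sup>2)"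
    by (intro ln_mono; simp)+
  then show ?thesis unfolding excess_def by linarith
qed

section \<open>Deterministic analysis of the minimisers along one sample path\<close>

text \<open>If |d| is large, more than 3/4 of the observations contribute at least \<open>?a\<close>
  and each of the others at least -\<open>?b\<close>. Both grow like 2 ln |d|, so the total would be
  positive; any fraction above 1/2 would serve.\<close>

lemma minimizer_bounded:
  fixes z d :: "nat \<Rightarrow> real"
  assumes min: "\<forall>\<^sub>F n in sequentially. (\<Sum>i<n. excess (d n) (z i)) \<le> 0"
    and K: "0 \<le> K" and freq: "(\<lambda>n. (\<Sum>i<n. indicator {- K..K} (z i)) / n) \<longlonglongrightarrow> p" and p: "3 / 4 < p"
  shows "\<exists>R. \<forall>\<^sub>F n in sequentially. \<bar>d n\<bar> \<le> R"
proof -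
  let ?a = "\<lambda>t. ln (1 + (t - K)\<^sup>2) - ln (1 + K\<^sup>2)" and ?b = "\<lambda>t. ln 2 + ln (1 + t\<^sup>2)"
  have "filterlim (\<lambda>t. 3 * ln (1 + (t - K)\<^sup>2) - ln (1 + t\<^sup>2)) at_top at_top" by real_asymp
  then have "\<forall>\<^sub>F t in at_top. 3 * ln (1 + K\<^sup>2) + ln 2 < 3 * ln (1 + (t - K)\<^sup>2) - ln (1 + t\<^sup>2)"
    by (simp add: filterlim_at_top_dense)
  then have "\<forall>\<^sub>F t in at_top. 0 < 3 * ?a t - ?b t \<and> K \<le> t"
    using eventually_ge_at_top[of K] by eventually_elim simp
  then obtain R where R: "\<And>t. R \<le> t \<Longrightarrow> 0 < 3 * ?a t - ?b t \<and> K \<le> t"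
    unfolding eventually_at_top_linorder by blast
  have "\<forall>\<^sub>F n in sequentially. 3 / 4 < (\<Sum>i<n. indicator {- K..K} (z i)) / real n"
    using freq p by (rule order_tendstoD)
  with min have "\<forall>\<^sub>F n in sequentially. \<bar>d n\<bar> \<le> R"
    using eventually_gt_at_top[of 0]
  proof eventually_elim
    case (elim n)
    show ?case
    proof (rule ccontr)
      assume "\<not> \<bar>d n\<bar> \<le> R"
      define a b where "a = ?a \<bar>d n\<bar>" and "b = ?b \<bar>d n\<bar>"
      from \<open>\<not> \<bar>d n\<bar> \<le> R\<close> have gt: "0 < 3 * a - b" "K \<le> \<bar>d n\<bar>"
        using R[of "\<bar>d n\<bar>"] by (auto simp: a_def b_def)
      let ?I = "\<lambda>i. indicator {- K..K} (z i) :: real"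
      have b0: "0 \<le> b" unfolding b_def by (intro add_nonneg_nonneg) auto
      \<comment> \<open>The summand is a inside the interval and -b outside it.\<close>
      have "(\<Sum>i<n. ?I i * (a + b) - b) \<le> (\<Sum>i<n. excess (d n) (z i))"
      proof (rule sum_mono)
        fix i
        show "?I i * (a + b) - b \<le> excess (d n) (z i)"
          using excess_lower_near[of "z i" K "d n"] excess_lower[of "d n" "z i"] gt(2)
          by (auto simp: indicator_def abs_le_iff a_def b_def)
      qed
      also have "\<dots> \<le> 0" by fact
      finally have "(\<Sum>i<n. ?I i) * (a + b) \<le> n * b"
        by (simp only: sum_subtractf sum_distrib_right[symmetric] sum_constant card_lessThan diff_le_0_iff_le)
      moreover have "3 / 4 * n \<le> (\<Sum>i<n. ?I i)" using elim by (simp add: field_simps)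
      then have "3 / 4 * n * (a + b) \<le> (\<Sum>i<n. ?I i) * (a + b)"
      proof (rule mult_right_mono)
        show "0 \<le> a + b" using gt b0 by linarith
      qed
      ultimately have "n * (3 / 4 * (a + b)) \<le> n * b"
        by (simp add: mult_ac)
      then have "3 / 4 * (a + b) \<le> b"
        by (rule mult_left_le_imp_le) (use elim in simp)
      with gt(1) show False by (simp add: distrib_left)
    qed
  qed
  then show ?thesis by blast
qed

text \<open>Wald's compactness argument: finitely many balls cover e \<le> |t| \<le> R, and around
  each centre the Lipschitz bound keeps the average contrast positive. Centres are rational so that
  countably many almost sure limits suffice.\<close>

lemma minimizer_tendsto_zero:
  fixes z d :: "nat \<Rightarrow> real" and \<mu> :: "real \<Rightarrow> real"
  assumes min: "\<forall>\<^sub>F n in sequentially. (\<Sum>i<n. excess (d n) (z i)) \<le> 0"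
    and bounded: "\<forall>\<^sub>F n in sequentially. \<bar>d n\<bar> \<le> R"
    and lim: "\<And>r. r \<in> \<rat> \<Longrightarrow> (\<lambda>n. (\<Sum>i<n. excess r (z i)) / n) \<longlonglongrightarrow> \<mu> r"
    and pos: "\<And>t. t \<noteq> 0 \<Longrightarrow> 0 < \<mu> t"
    and lip: "\<And>s t. \<bar>\<mu> s - \<mu> t\<bar> \<le> \<bar>s - t\<bar>"
  shows "d \<longlonglongrightarrow> 0"
proof (rule tendstoI)
  fix e :: real assume e: "0 < e"
  define S where "S = {- R..R} - ball 0 e"
  have cS: "compact S" unfolding S_def by (intro compact_diff) auto
  have cover: "S \<subseteq> (\<Union>r\<in>{r\<in>\<rat>. 0 < \<mu> r}. ball r (\<mu> r / 2))"
  proof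
    fix t assume "t \<in> S"
    then have "t \<noteq> 0" using e by (auto simp: S_def)
    then have mt: "0 < \<mu> t" by (rule pos)
    \<comment> \<open>Moving by less than \<mu> t / 4 keeps \<mu> r above 3/4 \<mu> t, hence t
      within \<mu> r / 2 of r.\<close>
    obtain r where r: "r \<in> \<rat>" "t - \<mu> t / 4 < r" "r < t"
      using Rats_dense_in_real[of "t - \<mu> t / 4" t] mt by auto
    have "3 / 4 * \<mu> t < \<mu> r" using lip[of r t] r by linarith
    with r mt have "0 < \<mu> r" "dist r t < \<mu> r / 2" by (auto simp: dist_real_def)
    with r show "t \<in> (\<Union>r\<in>{r\<in>\<rat>. 0 < \<mu> r}. ball r (\<mu> r / 2))" by auto
  qed
  obtain F where F: "F \<subseteq> {r\<in>\<rat>. 0 < \<mu> r}" "finite F" "S \<subseteq> (\<Union>r\<in>F. ball r (\<mu> r / 2))"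
    by (rule compactE_image[OF cS _ cover]) auto
  have "\<forall>\<^sub>F n in sequentially. \<forall>r\<in>F. \<mu> r / 2 < (\<Sum>i<n. excess r (z i)) / n"
  proof (intro eventually_ball_finite F ballI)
    fix r assume "r \<in> F"
    then have "r \<in> \<rat>" "\<mu> r / 2 < \<mu> r" using F by auto
    then show "\<forall>\<^sub>F n in sequentially. \<mu> r / 2 < (\<Sum>i<n. excess r (z i)) / n"
      using lim order_tendstoD by blast
  qed
  then show "\<forall>\<^sub>F n in sequentially. dist (d n) 0 < e"
    using min bounded eventually_gt_at_top[of 0]
  proof eventually_elim
    case (elim n)
    show ?case
    proof (rule ccontr)
      assume "\<not> dist (d n) 0 < e"
      then have "d n \<in> S" using elim by (auto simp: S_def dist_real_def)
      then obtain r where r: "r \<in> F" "\<bar>r - d n\<bar> < \<mu> r / 2" using F by (auto simp: dist_real_def)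
      have "(\<Sum>i<n. excess r (z i)) \<le> (\<Sum>i<n. excess (d n) (z i) + \<bar>r - d n\<bar>)"
      proof (rule sum_mono)
        fix i show "excess r (z i) \<le> excess (d n) (z i) + \<bar>r - d n\<bar>"
          using excess_lipschitz[of r "z i" "d n"] by linarith
      qed
      also have "\<dots> \<le> n * \<bar>r - d n\<bar>" using elim by (simp add: sum.distrib)
      finally have "(\<Sum>i<n. excess r (z i)) / n \<le> \<bar>r - d n\<bar>"
        using elim by (simp add: divide_le_eq mult.commute)
      with elim r show False by fastforce
    qed
  qed
qed

text \<open>The summed score vanishes at the minimiser; the mean value theorem between 0 and d does
  the rest. The case d = 0 is separate because that theorem needs a proper interval.\<close>

lemma minimizer_linearization:
  fixes z :: "nat \<Rightarrow> real"
  assumes min: "\<And>t. (\<Sum>i<n. ln (1 + (z i - d)\<^sup>2)) \<le> (\<Sum>i<n. ln (1 + (z i - t)\<^sup>2))"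
  obtains \<xi> where "\<bar>\<xi>\<bar> \<le> \<bar>d\<bar>" and "(\<Sum>i<n. score (z i)) = d * (\<Sum>i<n. score_deriv (z i - \<xi>))"
proof -
  let ?g = "\<lambda>t. \<Sum>i<n. score (z i - t)" and ?g' = "\<lambda>t. \<Sum>i<n. - score_deriv (z i - t)"
  have dg: "(?g has_real_derivative ?g' t) (at t)" for t
  proof (rule DERIV_sum)
    fix i
    have "((\<lambda>t. score (z i - t)) has_real_derivative score_deriv (z i - t) * (-1)) (at t)"
      by (rule DERIV_chain2[OF has_derivative_score]) (auto intro!: derivative_eq_intros)
    then show "((\<lambda>t. score (z i - t)) has_real_derivative - score_deriv (z i - t)) (at t)" by simp
  qed
  have dL: "((\<lambda>t. \<Sum>i<n. ln (1 + (z i - t)\<^sup>2)) has_real_derivative (\<Sum>i<n. - score (z i - t))) (at t)" for t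
  proof (rule DERIV_sum)
    fix i
    have "((\<lambda>t. ln (1 + (z i - t)\<^sup>2)) has_real_derivative score (z i - t) * (-1)) (at t)"
      by (rule DERIV_chain2[OF has_derivative_ln_one_plus_square]) (auto intro!: derivative_eq_intros)
    then show "((\<lambda>t. ln (1 + (z i - t)\<^sup>2)) has_real_derivative - score (z i - t)) (at t)" by simp
  qed
  have "(\<Sum>i<n. - score (z i - d)) = 0"
    using dL by (rule DERIV_local_min[where d=1]) (use min in auto)
  then have gd: "?g d = 0" by (simp add: sum_negf)
  consider "d = 0" | "0 < d" | "d < 0" by linarith
  then show ?thesis
  proof cases
    case 1
    then show ?thesis using gd by (intro that[of 0]) auto
  next
    case 2
    obtain \<xi> where "0 < \<xi>" "\<xi> < d" "?g d - ?g 0 = (d - 0) * ?g' \<xi>"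
      using MVT2[of 0 d ?g ?g', OF 2 dg] by blast
    then show ?thesis using gd by (intro that[of \<xi>]) (auto simp: sum_negf)
  next
    case 3
    obtain \<xi> where "d < \<xi>" "\<xi> < 0" "?g 0 - ?g d = (0 - d) * ?g' \<xi>"
      using MVT2[of d 0 ?g ?g', OF 3 dg] by blast
    then show ?thesis using gd by (intro that[of \<xi>]) (auto simp: sum_negf)
  qed
qed

text \<open>The normalised error is the normalised score sum times 1 / \<open>A n\<close>, and
  \<open>A n\<close> tends to J because shifting the arguments by \<open>\<xi> n\<close> changes the
  average by at most 10 |d n|. A positive convergent factor passes through the limsup.\<close>

lemma limsup_minimizer:
  fixes z d :: "nat \<Rightarrow> real"
  assumes min: "\<And>n t. 0 < (n::nat) \<Longrightarrow> (\<Sum>i<n. ln (1 + (z i - d n)\<^sup>2)) \<le> (\<Sum>i<n. ln (1 + (z i - t)\<^sup>2))"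
    and d0: "d \<longlonglongrightarrow> 0"
    and J: "(\<lambda>n. (\<Sum>i<n. score_deriv (z i)) / real n) \<longlonglongrightarrow> J" "0 < J"
    and LIL: "limsup (\<lambda>n. ereal ((\<Sum>i<n. score (z i)) / sqrt (real n * ln (ln (real n))))) = ereal L"
  shows "limsup (\<lambda>n. ereal (sqrt (real n / ln (ln (real n))) * d n)) = ereal (L / J)"
proof -
  have "\<exists>\<xi>. \<bar>\<xi>\<bar> \<le> \<bar>d n\<bar> \<and> (\<Sum>i<n. score (z i)) = d n * (\<Sum>i<n. score_deriv (z i - \<xi>))" for n
  proof (cases "n = 0")
    case False
    then show ?thesis using minimizer_linearization[where n=n and z=z and d="d n"] min[of n] by blast
  qed auto
  then obtain \<xi> where \<xi>: "\<And>n. \<bar>\<xi> n\<bar> \<le> \<bar>d n\<bar>"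
      "\<And>n. (\<Sum>i<n. score (z i)) = d n * (\<Sum>i<n. score_deriv (z i - \<xi> n))"
    by metis
  define A where "A n = (\<Sum>i<n. score_deriv (z i - \<xi> n)) / n" for n
  have "A \<longlonglongrightarrow> J"
  proof -
    have bound: "\<bar>A n - (\<Sum>i<n. score_deriv (z i)) / n\<bar> \<le> 10 * \<bar>d n\<bar>" for n
    proof -
      have "\<bar>(\<Sum>i<n. score_deriv (z i - \<xi> n)) - (\<Sum>i<n. score_deriv (z i))\<bar>
          \<le> (\<Sum>i<n. \<bar>score_deriv (z i - \<xi> n) - score_deriv (z i)\<bar>)"
        unfolding sum_subtractf[symmetric] by (rule sum_abs)
      also have "\<dots> \<le> (\<Sum>i<n. 10 * \<bar>d n\<bar>)"
      proof (rule sum_mono)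
        fix i show "\<bar>score_deriv (z i - \<xi> n) - score_deriv (z i)\<bar> \<le> 10 * \<bar>d n\<bar>"
          using score_deriv_lipschitz[of "z i - \<xi> n" "z i"] \<xi>(1)[of n] by simp
      qed
      also have "\<dots> = n * (10 * \<bar>d n\<bar>)" by simp
      finally show ?thesis
        by (cases "n = 0") (simp_all add: A_def diff_divide_distrib[symmetric] abs_divide divide_le_eq mult.commute)
    qed
    have "(\<lambda>n. A n - (\<Sum>i<n. score_deriv (z i)) / real n) \<longlonglongrightarrow> 0"
    proof (rule Lim_null_comparison)
      show "\<forall>\<^sub>F n in sequentially. norm (A n - (\<Sum>i<n. score_deriv (z i)) / real n) \<le> 10 * \<bar>d n\<bar>"
        by (intro always_eventually allI) (simp only: real_norm_def bound)
      show "(\<lambda>n. 10 * \<bar>d n\<bar>) \<longlonglongrightarrow> 0"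
        using tendsto_mult_right_zero[OF tendsto_rabs_zero[OF d0], of 10] .
    qed
    from tendsto_add[OF this J(1)] show ?thesis by simp
  qed
  note A_lim = this
  have A: "(\<lambda>n. ereal (1 / A n)) \<longlonglongrightarrow> ereal (1 / J)" "\<forall>\<^sub>F n in sequentially. 0 < A n"
  proof -
    show "(\<lambda>n. ereal (1 / A n)) \<longlonglongrightarrow> ereal (1 / J)"
      using A_lim J(2) by (intro tendsto_ereal tendsto_divide tendsto_const) auto
    show "\<forall>\<^sub>F n in sequentially. 0 < A n"
      using A_lim J(2) by (rule order_tendstoD)
  qed
  have pos: "\<forall>\<^sub>F n::nat in sequentially. 0 < ln (ln (real n))" by real_asymp
  have eq: "\<forall>\<^sub>F n in sequentially. ereal (sqrt (real n / ln (ln (real n))) * d n)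
      = ereal (1 / A n) * ereal ((\<Sum>i<n. score (z i)) / sqrt (real n * ln (ln (real n))))"
    using A(2) pos eventually_gt_at_top[of 0]
  proof eventually_elim
    case (elim n)
    have "(\<Sum>i<n. score (z i)) = d n * (n * A n)" using elim by (simp add: \<xi>(2) A_def)
    moreover have "sqrt (real n / ln (ln (real n))) = n / sqrt (real n * ln (ln (real n)))"
    proof -
      have "real n = sqrt n * sqrt n" by simp
      then show ?thesis using elim by (simp add: real_sqrt_mult real_sqrt_divide field_simps)
    qed
    ultimately show ?case using elim by simp
  qed
  have "limsup (\<lambda>n. ereal (sqrt (real n / ln (ln (real n))) * d n))
      = limsup (\<lambda>n. ereal (1 / A n) * ereal ((\<Sum>i<n. score (z i)) / sqrt (real n * ln (ln (real n)))))"
    by (rule Limsup_eq[OF eq])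
  also have "\<dots> = ereal (1 / J) * limsup (\<lambda>n. ereal ((\<Sum>i<n. score (z i)) / sqrt (real n * ln (ln (real n)))))"
    by (rule ereal_limsup_lim_mult[OF A(1)]) (use J(2) in auto)
  also have "\<dots> = ereal (L / J)" by (simp add: LIL)
  finally show ?thesis .
qed

section \<open>Moments of the Pearson type VII law\<close>

text \<open>Reflection is valid even without integrability, since both integrals then default to
  0.\<close>

lemma integral_odd_eq_zero:
  fixes g :: "real \<Rightarrow> real"
  assumes "\<And>x. g (- x) = - g x"
  shows "(\<integral>x. g x \<partial>lborel) = 0"
  using lborel_integral_real_affine[of "-1" g 0] assms by simp

lemma integrable_one_plus_square_powr_mono:
  fixes p q :: real
  assumes "p \<le> q" and int: "integrable lborel (\<lambda>x::real. (1 + x\<^sup>2) powr (- p))"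
  shows "integrable lborel (\<lambda>x::real. (1 + x\<^sup>2) powr (- q))"
proof (rule Bochner_Integration.integrable_bound[OF int])
  show "AE x::real in lborel. norm ((1 + x\<^sup>2) powr (- q)) \<le> norm ((1 + x\<^sup>2) powr (- p))"
    using assms(1) by (intro AE_I2) (auto intro!: powr_mono)
qed simp

text \<open>
  Integrating the derivative \<open>(1 - 2 p) (1 + x\<^sup>2)\<^bsup>-p\<^esup> + 2 p (1 + x\<^sup>2)\<^bsup>-(p+1)\<^esup>\<close> of
  \<open>x (1 + x\<^sup>2)\<^bsup>-p\<^esup>\<close>, which vanishes at infinity for \<open>p > 1/2\<close>.
\<close>

lemma integral_one_plus_square_powr_Suc:
  fixes p :: real
  assumes p: "1 / 2 < p" and int: "integrable lborel (\<lambda>x::real. (1 + x\<^sup>2) powr (- p))"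
  shows "(\<integral>x. (1 + x\<^sup>2) powr (- (p + 1)) \<partial>lborel) = (2 * p - 1) / (2 * p) * (\<integral>x. (1 + x\<^sup>2) powr (- p) \<partial>lborel)"
proof -
  let ?F = "\<lambda>x::real. x * (1 + x\<^sup>2) powr (- p)"
  let ?f = "\<lambda>x::real. (1 - 2 * p) * (1 + x\<^sup>2) powr (- p) + 2 * p * (1 + x\<^sup>2) powr (- (p + 1))"
  have int': "integrable lborel (\<lambda>x::real. (1 + x\<^sup>2) powr (- (p + 1)))"
    by (rule integrable_one_plus_square_powr_mono[OF _ int]) simp
  have intf: "integrable lborel ?f" by (intro Bochner_Integration.integrable_add integrable_mult_right int int')
  have "(LBINT x=-\<infinity>..\<infinity>. ?f x) = 0 - 0"
  proof (rule interval_integral_FTC_integrable[where F="?F"])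
    fix x :: real
    have "(?F has_real_derivative (1 + x\<^sup>2) powr (- p) + x * (- p * (1 + x\<^sup>2) powr (- p - 1) * (2 * x))) (at x)"
      by (auto intro!: derivative_eq_intros simp: algebra_simps)
    moreover have "(1 + x\<^sup>2) powr (- p) + x * (- p * (1 + x\<^sup>2) powr (- p - 1) * (2 * x)) = ?f x"
    proof -
      have "(1 + x\<^sup>2) powr (- p) = (1 + x\<^sup>2) * (1 + x\<^sup>2) powr (- p - 1)"
        using powr_add[of "1 + x\<^sup>2" 1 "- p - 1"] by simp
      moreover have "- (p + 1) = - p - 1" by simp
      ultimately show ?thesis by (simp only:) (simp add: algebra_simps power2_eq_square)
    qed
    ultimately show "(?F has_vector_derivative ?f x) (at x)"
      by (simp add: has_real_derivative_iff_has_vector_derivative)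
    show "isCont ?f x" by (intro continuous_intros) auto
  next
    show "set_integrable lborel (einterval (-\<infinity>) \<infinity>) ?f"
      using intf by (simp add: set_integrable_def)
    have "(?F \<longlongrightarrow> 0) at_top" "(?F \<longlongrightarrow> 0) at_bot" using p by real_asymp+
    then show "((?F \<circ> real_of_ereal) \<longlongrightarrow> 0) (at_right (-\<infinity>))" "((?F \<circ> real_of_ereal) \<longlongrightarrow> 0) (at_left \<infinity>)"
      by (simp_all add: ereal_tendsto_simps)
  qed simp
  moreover have "(LBINT x=-\<infinity>..\<infinity>. ?f x) = (\<integral>x. ?f x \<partial>lborel)"
    by (simp add: interval_lebesgue_integral_def set_lebesgue_integral_def)
  moreover have "(\<integral>x. ?f x \<partial>lborel) = (1 - 2 * p) * (\<integral>x. (1 + x\<^sup>2) powr (- p) \<partial>lborel)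
      + 2 * p * (\<integral>x. (1 + x\<^sup>2) powr (- (p + 1)) \<partial>lborel)"
    using int int' by simp
  ultimately show ?thesis using p by (simp add: field_simps)
qed

section \<open>The centred sample: moments, Gibbs' inequality and the limit theorem\<close>

locale pvii_sample = prob_space +
  fixes Z :: "nat \<Rightarrow> 'a \<Rightarrow> real" and m :: real
  assumes m: "1 / 2 < m"
    and indep: "indep_vars (\<lambda>_. borel) Z UNIV"
    and distributed: "distributed M lborel (Z i) (\<lambda>x. ennreal (pvii_density m x))"
begin

sublocale iid_sequence M Z
proof
  show "indep_vars (\<lambda>_. borel) Z UNIV" by (rule indep)
  have "distr M borel (Z i) = distr M lborel (Z i)" for i by (rule distr_cong) auto
  then show "distr M borel (Z i) = distr M borel (Z 0)" for i
    using distributed_distr_eq_density[OF distributed] by metis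
qed

lemma pvii_density_nonneg: "0 \<le> pvii_density m x"
  by (simp add: pvii_density_def pvii_const_def)

lemma expectation_density:
  assumes [measurable]: "g \<in> borel_measurable borel"
  shows "expectation (\<lambda>\<omega>. g (Z i \<omega>)) = (\<integral>x. pvii_density m x * g x \<partial>lborel)"
  using distributed_integral[OF distributed, of g i] pvii_density_nonneg by simp

text \<open>The total mass is read off from the law of \<open>Z 0\<close>. Being nonzero, it
  excludes the default value of a divergent integral, so integrability and positivity of the
  constant follow without evaluating \<open>pvii_const\<close>.\<close>

lemma integral_density: "(\<integral>x. pvii_density m x \<partial>lborel) = 1"
  using expectation_density[of "\<lambda>_. 1" 0] by (simp add: prob_space)

lemma integrable_density: "integrable lborel (pvii_density m)"
  using integral_density not_integrable_integral_eq by fastforce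

lemma pvii_const_pos: "0 < pvii_const m"
proof -
  have "pvii_const m \<noteq> 0" using integral_density by (auto simp: pvii_density_def)
  then show ?thesis by (simp add: pvii_const_def less_le)
qed

lemma integrable_powr: "integrable lborel (\<lambda>x::real. (1 + x\<^sup>2) powr (- m))"
  using integrable_density pvii_const_pos by (simp add: pvii_density_def[abs_def])

lemma integral_powr: "pvii_const m * (\<integral>x. (1 + x\<^sup>2) powr (- m) \<partial>lborel) = 1"
  using integral_density by (simp add: pvii_density_def)

lemma pvii_density_pos: "0 < pvii_density m x"
  using pvii_const_pos by (simp add: pvii_density_def)

lemma integrable_density_times:
  assumes [measurable]: "g \<in> borel_measurable borel" and "\<And>x. \<bar>g x\<bar> \<le> C"
  shows "integrable lborel (\<lambda>x. pvii_density m x * g x)"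
proof (rule Bochner_Integration.integrable_bound)
  show "integrable lborel (\<lambda>x. C * pvii_density m x)" using integrable_density by simp
  show "(\<lambda>x. pvii_density m x * g x) \<in> borel_measurable lborel"
    using borel_measurable_integrable[OF integrable_density] by simp
  have "0 \<le> C" using assms(2)[of 0] by linarith
  then show "AE x in lborel. norm (pvii_density m x * g x) \<le> norm (C * pvii_density m x)"
    using mult_right_mono[OF assms(2) pvii_density_nonneg] pvii_density_nonneg
    by (intro AE_I2) (simp add: abs_mult mult.commute)
qed

text \<open>Each factor 1 / (1 + x^2) raises the exponent by one, so the recursion in the exponent
  applies. The values are the first two moments of the Beta (m - 1/2, 1/2) law.\<close>

lemma inverse_moments:
  shows "expectation (\<lambda>\<omega>. 1 / (1 + (Z i \<omega>)\<^sup>2)) = (2 * m - 1) / (2 * m)" (is "?E1 = ?A")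
    and "expectation (\<lambda>\<omega>. (1 / (1 + (Z i \<omega>)\<^sup>2))\<^sup>2) = (2 * m - 1) / (2 * m) * ((2 * m + 1) / (2 * m + 2))" (is "?E2 = _")
proof -
  let ?I = "\<lambda>p. \<integral>x. (1 + x\<^sup>2) powr (- p) \<partial>lborel"
  have powr_step: "(1 + x\<^sup>2) powr (- p) * (1 / (1 + x\<^sup>2)) = (1 + x\<^sup>2) powr (- (p + 1))" for x p :: real
    using powr_add[of "1 + x\<^sup>2" "- p" "-1"] by (simp add: powr_minus_divide)
  have I1: "?I (m + 1) = ?A * ?I m"
    by (rule integral_one_plus_square_powr_Suc[OF m integrable_powr])
  have "?I (m + 1 + 1) = (2 * (m + 1) - 1) / (2 * (m + 1)) * ?I (m + 1)"
    using m by (intro integral_one_plus_square_powr_Suc integrable_one_plus_square_powr_mono[OF _ integrable_powr]) auto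
  then have I2: "?I (m + 1 + 1) = (2 * m + 1) / (2 * m + 2) * (?A * ?I m)"
    unfolding I1 by (simp add: algebra_simps)
  have "?E1 = (\<integral>x. pvii_const m * (1 + x\<^sup>2) powr (- (m + 1)) \<partial>lborel)"
    by (subst expectation_density) (simp_all only: pvii_density_def mult.assoc powr_step, measurable)
  also have "\<dots> = ?A * (pvii_const m * ?I m)" by (simp only: integral_mult_right_zero I1) simp
  finally show "?E1 = ?A" by (simp add: integral_powr)
  have "?E2 = (\<integral>x. pvii_const m * (1 + x\<^sup>2) powr (- (m + 1 + 1)) \<partial>lborel)"
    by (subst expectation_density) (simp_all only: pvii_density_def power2_eq_square[of "1 / _"] mult.assoc[symmetric],
       simp_all only: mult.assoc[of "pvii_const m"] powr_step, measurable)
  also have "\<dots> = ?A * ((2 * m + 1) / (2 * m + 2)) * (pvii_const m * ?I m)"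
    by (simp only: integral_mult_right_zero I2) (simp add: mult_ac)
  finally show "?E2 = ?A * ((2 * m + 1) / (2 * m + 2))" by (simp add: integral_powr)
qed

lemma integrable_inverse:
  "integrable M (\<lambda>\<omega>. 1 / (1 + (Z i \<omega>)\<^sup>2))" "integrable M (\<lambda>\<omega>. (1 / (1 + (Z i \<omega>)\<^sup>2))\<^sup>2)"
proof -
  have le1: "1 / (1 + x\<^sup>2) \<le> 1" for x :: real by (simp add: divide_le_eq)
  show "integrable M (\<lambda>\<omega>. 1 / (1 + (Z i \<omega>)\<^sup>2))"
    by (rule integrable_const_bound[where B=1]) (auto simp: le1)
  show "integrable M (\<lambda>\<omega>. (1 / (1 + (Z i \<omega>)\<^sup>2))\<^sup>2)"
    by (rule integrable_const_bound[where B=1]) (use le1 in \<open>auto intro!: power_le_one simp del: power_divide simp: power_divide[symmetric]\<close>)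
qed

lemma expectation_score: "expectation (\<lambda>\<omega>. score (Z i \<omega>)) = 0"
  by (subst expectation_density) (auto intro!: integral_odd_eq_zero simp: score_def pvii_density_def)

lemma expectation_score_square: "expectation (\<lambda>\<omega>. (score (Z i \<omega>))\<^sup>2) = (2 * m - 1) / (m * (m + 1))"
proof -
  have sq: "(score u)\<^sup>2 = 4 * (1 / (1 + u\<^sup>2)) - 4 * (1 / (1 + u\<^sup>2))\<^sup>2" for u
    by (simp add: score_def divide_simps) (simp add: power2_eq_square algebra_simps)
  have "expectation (\<lambda>\<omega>. (score (Z i \<omega>))\<^sup>2)
      = 4 * expectation (\<lambda>\<omega>. 1 / (1 + (Z i \<omega>)\<^sup>2)) - 4 * expectation (\<lambda>\<omega>. (1 / (1 + (Z i \<omega>)\<^sup>2))\<^sup>2)"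
    by (simp only: sq Bochner_Integration.integral_diff[OF integrable_mult_right[OF integrable_inverse(1)]
          integrable_mult_right[OF integrable_inverse(2)]] integral_mult_right_zero)
  also have "\<dots> = (2 * m - 1) / (m * (m + 1))"
    unfolding inverse_moments using m by (simp add: divide_simps) (simp add: algebra_simps power2_eq_square)
  finally show ?thesis .
qed

text \<open>Equals m times the mean square of the score, the information identity for the
  log-likelihood factor m; here it comes out of the inverse moments.\<close>

lemma expectation_score_deriv: "expectation (\<lambda>\<omega>. score_deriv (Z i \<omega>)) = (2 * m - 1) / (m + 1)"
proof -
  have "expectation (\<lambda>\<omega>. score_deriv (Z i \<omega>))
      = 4 * expectation (\<lambda>\<omega>. (1 / (1 + (Z i \<omega>)\<^sup>2))\<^sup>2) - 2 * expectation (\<lambda>\<omega>. 1 / (1 + (Z i \<omega>)\<^sup>2))"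
    by (simp only: score_deriv_def Bochner_Integration.integral_diff[OF integrable_mult_right[OF integrable_inverse(2)]
          integrable_mult_right[OF integrable_inverse(1)]] integral_mult_right_zero)
  also have "\<dots> = (2 * m - 1) / (m + 1)"
    unfolding inverse_moments using m by (simp add: divide_simps) (simp add: algebra_simps power2_eq_square)
  finally show ?thesis .
qed

lemma LIL_score:
  "AE \<omega> in M. limsup (\<lambda>n. ereal ((\<Sum>i<n. score (Z i \<omega>)) / sqrt (n * ln (ln n))))
     = ereal (sqrt 2 * sqrt ((2 * m - 1) / (m * (m + 1))))"
proof -
  interpret S: bounded_centred_iid M "\<lambda>i \<omega>. score (Z i \<omega>)" 1 "sqrt ((2 * m - 1) / (m * (m + 1)))"
  proof unfold_locales
    show "indep_vars (\<lambda>_. borel) (\<lambda>i \<omega>. score (Z i \<omega>)) UNIV"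
      by (rule indep_vars_compose2[OF indep]) auto
    have "distr M borel (\<lambda>\<omega>. score (Z i \<omega>)) = distr (distr M borel (Z i)) borel score" for i
      by (subst distr_distr) (auto simp: comp_def)
    then show "distr M borel (\<lambda>\<omega>. score (Z i \<omega>)) = distr M borel (\<lambda>\<omega>. score (Z 0 \<omega>))" for i
      using distr_eq[of i] by simp
  qed (use m in \<open>auto simp: abs_score_le expectation_score expectation_score_square\<close>)
  show ?thesis using S.LIL unfolding S.partial_sum_def .
qed

definition mean_excess :: "real \<Rightarrow> real" where
  "mean_excess t = expectation (\<lambda>\<omega>. excess t (Z 0 \<omega>))"

lemma integrable_excess: "integrable M (\<lambda>\<omega>. excess t (Z 0 \<omega>))"
  by (rule integrable_const_bound[where B="\<bar>t\<bar>"]) (auto simp: abs_excess_le)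

lemma mean_excess_lipschitz: "\<bar>mean_excess s - mean_excess t\<bar> \<le> \<bar>s - t\<bar>"
proof -
  have "mean_excess s - mean_excess t = expectation (\<lambda>\<omega>. excess s (Z 0 \<omega>) - excess t (Z 0 \<omega>))"
    unfolding mean_excess_def using integrable_excess by simp
  also have "\<bar>\<dots>\<bar> \<le> expectation (\<lambda>\<omega>. \<bar>excess s (Z 0 \<omega>) - excess t (Z 0 \<omega>)\<bar>)"
    by (rule integral_abs_bound)
  also have "\<dots> \<le> expectation (\<lambda>\<omega>. \<bar>s - t\<bar>)"
    using integrable_excess by (intro integral_mono) (auto simp: excess_lipschitz)
  finally show ?thesis by (simp add: prob_space)
qed

text \<open>m times the mean excess is the Kullback-Leibler divergence between the density and its
  translate by t.\<close>

lemma mean_excess_pos: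
  assumes "t \<noteq> 0"
  shows "0 < mean_excess t"
proof (rule ccontr)
  assume "\<not> 0 < mean_excess t"
  let ?f = "pvii_density m"
  \<comment> \<open>The two added densities have equal mass, so the integral is unchanged, while the
    integrand becomes f (exp y - 1 - y) \<ge> 0 with y = - m * excess.\<close>
  define G where "G x = m * (?f x * excess t x) - ?f x + ?f (x - t)" for x
  have shift: "?f (x - t) = ?f x * exp (- m * excess t x)" for x
  proof -
    have "(1 + (x - t)\<^sup>2) powr (- m) = (1 + x\<^sup>2) powr (- m) * exp (- m * excess t x)"
      by (simp add: powr_def excess_def exp_add[symmetric] algebra_simps)
    then show ?thesis by (simp add: pvii_density_def)
  qed
  have G_eq: "G x = ?f x * (exp (- m * excess t x) - (1 + (- m * excess t x)))" for x
    unfolding G_def shift by (simp add: algebra_simps)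
  have G0: "0 \<le> G x" for x
    unfolding G_eq using exp_ge_add_one_self[of "- m * excess t x"]
    by (intro mult_nonneg_nonneg[OF pvii_density_nonneg]) linarith
  have int1: "integrable lborel (\<lambda>x. ?f x * excess t x)"
    by (rule integrable_density_times[where C="\<bar>t\<bar>"]) (auto simp: abs_excess_le)
  have int2: "integrable lborel (\<lambda>x. ?f (x - t))" and eq2: "(\<integral>x. ?f (x - t) \<partial>lborel) = 1"
    using lborel_integrable_real_affine[OF integrable_density, of 1 "- t"]
      lborel_integral_real_affine[of 1 ?f "- t"] integral_density by simp_all
  have "integral\<^sup>L lborel G = m * mean_excess t"
    unfolding G_def mean_excess_def using int1 int2 eq2 integrable_density integral_density
    by (simp add: expectation_density)
  also have "\<dots> \<le> 0" using \<open>\<not> 0 < mean_excess t\<close> m by (simp add: mult_nonneg_nonpos)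
  finally have "integral\<^sup>L lborel G \<le> 0" .
  moreover have "0 \<le> integral\<^sup>L lborel G" using G0 by simp
  ultimately have "integral\<^sup>L lborel G = 0" by simp
  moreover have "integrable lborel G" unfolding G_def using int1 int2 integrable_density by simp
  ultimately have "AE x in lborel. G x = 0"
    using integral_nonneg_eq_0_iff_AE[of lborel G] G0 by simp
  \<comment> \<open>G vanishes only where (x - t)^2 = x^2, that is, only at the midpoint t /
    2.\<close>
  moreover have "AE x in lborel. x \<noteq> t / 2" by (rule AE_lborel_singleton)
  ultimately have "AE x in (lborel :: real measure). False"
  proof eventually_elim
    case (elim x)
    have "- m * excess t x = 0"
    proof -
      have "exp (- m * excess t x) = 1 + (- m * excess t x)"
        using elim(1) pvii_density_pos[of x] unfolding G_eq by simp
      then have "ln (exp (- m * excess t x)) = exp (- m * excess t x) - 1"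
        unfolding ln_exp by linarith
      then have "exp (- m * excess t x) = 1" by (rule ln_eq_minus_one[OF exp_gt_zero])
      then show ?thesis by simp
    qed
    then have "ln (1 + (x - t)\<^sup>2) = ln (1 + x\<^sup>2)" using m by (simp add: excess_def)
    then have "1 + (x - t)\<^sup>2 = 1 + x\<^sup>2" by (subst (asm) ln_inj_iff) auto
    then have "t * (t - 2 * x) = 0" by (simp add: power2_eq_square algebra_simps)
    with assms elim(2) show ?case by simp
  qed
  then have "emeasure lborel (UNIV :: real set) = 0" by (simp add: AE_iff_null null_sets_def)
  then show False by simp
qed

lemma concentrated: "\<exists>K\<ge>0. 3 / 4 < expectation (\<lambda>\<omega>. indicat_real {- K..K} (Z 0 \<omega>))"
proof -
  let ?A = "\<lambda>k::nat. {\<omega>\<in>space M. \<bar>Z 0 \<omega>\<bar> \<le> real k}"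
  have "(\<lambda>k. prob (?A k)) \<longlonglongrightarrow> prob (\<Union>k. ?A k)"
    by (rule finite_Lim_measure_incseq) (auto simp: incseq_def)
  also have "(\<Union>k. ?A k) = space M" using real_arch_simple by auto
  finally have "\<forall>\<^sub>F k in sequentially. 3 / 4 < prob (?A k)"
    by (rule order_tendstoD) (simp add: prob_space)
  then obtain k where k: "3 / 4 < prob (?A k)" using eventually_happens'[OF sequentially_bot] by blast
  have "expectation (\<lambda>\<omega>. indicat_real {- real k..real k} (Z 0 \<omega>)) = expectation (indicator (?A k))"
    by (intro Bochner_Integration.integral_cong) (auto simp: indicator_def abs_le_iff)
  also have "\<dots> = prob (?A k)" by simp
  finally show ?thesis using k by (intro exI[of _ "real k"]) simp
qed

text \<open>The probabilistic input consists of three strong laws and the iterated logarithm of the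
  scores; where they all hold, the deterministic lemmas apply to the single path.\<close>

theorem limsup_minimizer_AE:
  assumes min: "\<And>n \<omega> t. \<omega> \<in> space M \<Longrightarrow> 0 < (n::nat) \<Longrightarrow>
      (\<Sum>i<n. ln (1 + (Z i \<omega> - d n \<omega>)\<^sup>2)) \<le> (\<Sum>i<n. ln (1 + (Z i \<omega> - t)\<^sup>2))"
  shows "AE \<omega> in M. limsup (\<lambda>n. ereal (sqrt (n / ln (ln n)) * d n \<omega>))
     = ereal (sqrt (2 * (m + 1) / (m * (2 * m - 1))))"
proof -
  obtain K where K: "0 \<le> K" "3 / 4 < expectation (\<lambda>\<omega>. indicat_real {- K..K} (Z 0 \<omega>))"
    using concentrated by blast
  let ?J = "(2 * m - 1) / (m + 1)" and ?L = "sqrt 2 * sqrt ((2 * m - 1) / (m * (m + 1)))"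
  have J: "0 < ?J" using m by simp
  have const: "?L / ?J = sqrt (2 * (m + 1) / (m * (2 * m - 1)))"
  proof -
    have "sqrt (?J\<^sup>2) = ?J" using J m by simp
    then have "?L / ?J = ?L / sqrt (?J\<^sup>2)" by (simp only:)
    also have "\<dots> = sqrt (2 * ((2 * m - 1) / (m * (m + 1))) / ?J\<^sup>2)"
      by (simp only: real_sqrt_mult real_sqrt_divide)
    also have "2 * ((2 * m - 1) / (m * (m + 1))) / ?J\<^sup>2 = 2 * (m + 1) / (m * (2 * m - 1))"
      using m by (simp add: divide_simps) (simp add: power2_eq_square algebra_simps)
    finally show ?thesis .
  qed
  have "AE \<omega> in M. (\<lambda>n. (\<Sum>i<n. indicator {- K..K} (Z i \<omega>)) / n) \<longlonglongrightarrow> expectation (\<lambda>\<omega>. indicat_real {- K..K} (Z 0 \<omega>))"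
    by (rule SLLN_bounded[where C=1]) (auto simp: indicator_def)
  moreover have "AE \<omega> in M. \<forall>r\<in>\<rat>. (\<lambda>n. (\<Sum>i<n. excess r (Z i \<omega>)) / n) \<longlonglongrightarrow> mean_excess r"
    unfolding mean_excess_def
  proof (subst AE_ball_countable[OF countable_rat], intro ballI)
    fix r :: real
    show "AE \<omega> in M. (\<lambda>n. (\<Sum>i<n. excess r (Z i \<omega>)) / n) \<longlonglongrightarrow> expectation (\<lambda>\<omega>. excess r (Z 0 \<omega>))"
      by (rule SLLN_bounded[where C="\<bar>r\<bar>"]) (auto simp: abs_excess_le)
  qed
  moreover have "AE \<omega> in M. (\<lambda>n. (\<Sum>i<n. score_deriv (Z i \<omega>)) / n) \<longlonglongrightarrow> ?J"
    using SLLN_bounded[of score_deriv 6] abs_score_deriv_le expectation_score_deriv[of 0] by simp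
  ultimately show ?thesis
    using LIL_score AE_space
  proof eventually_elim
    case (elim \<omega>)
    have le0: "\<forall>\<^sub>F n in sequentially. (\<Sum>i<n. excess (d n \<omega>) (Z i \<omega>)) \<le> 0"
      using eventually_gt_at_top[of 0]
    proof eventually_elim
      case (elim n)
      with min[OF \<open>\<omega> \<in> space M\<close>, of n 0] show ?case by (simp add: excess_def sum_subtractf)
    qed
    obtain R where R: "\<forall>\<^sub>F n in sequentially. \<bar>d n \<omega>\<bar> \<le> R"
      using minimizer_bounded[OF le0 K(1) elim(1) K(2)] by blast
    have "(\<lambda>n. d n \<omega>) \<longlonglongrightarrow> 0"
      by (rule minimizer_tendsto_zero[OF le0 R _ mean_excess_pos mean_excess_lipschitz]) (use elim(2) in auto)
    then have "limsup (\<lambda>n. ereal (sqrt (n / ln (ln n)) * d n \<omega>)) = ereal (?L / ?J)"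
      using min[OF elim(5)] elim(3) J elim(4) by (intro limsup_minimizer[where z="\<lambda>i. Z i \<omega>"])
    then show ?case by (simp only: const)
  qed
qed

end

section \<open>From the likelihood to the sum of logarithms\<close>

text \<open>The prefactor is positive and free of t, so for m > 0 maximising the likelihood is
  minimising the sum of logarithms.\<close>

lemma pvii_lik_eq_exp:
  assumes "0 < pvii_const m"
  shows "pvii_lik m n x t = pvii_const m ^ n * exp (- m * (\<Sum>i<n. ln (1 + (x i - t)\<^sup>2)))"
proof -
  have "pvii_density m (x i - t) = pvii_const m * exp (- m * ln (1 + (x i - t)\<^sup>2))" for i
    by (simp add: pvii_density_def powr_def)
  then show ?thesis by (simp add: pvii_lik_def prod.distrib exp_sum sum_distrib_left)
qed

theorem theorem1p3:
  fixes M :: "'w measure" and X :: "nat \<Rightarrow> 'w \<Rightarrow> real"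
    and est :: "nat \<Rightarrow> (nat \<Rightarrow> real) \<Rightarrow> real"
    and m \<theta> :: real
  assumes "prob_space M"
    and m: "m > 1/2"
    and indep: "prob_space.indep_vars M (\<lambda>_. borel) X UNIV"
    and distr: "\<And>i. distributed M lborel (X i) (\<lambda>x. ennreal (pvii_density m (x - \<theta>)))"
    and est_meas: "\<And>n. est n \<in> borel_measurable (PiM {..<n} (\<lambda>_. borel))"
    and est_mle: "\<And>n x t. x \<in> space (PiM {..<n} (\<lambda>_. (borel :: real measure))) \<Longrightarrow>
                     pvii_lik m n x t \<le> pvii_lik m n x (est n x)"
  shows "AE \<omega> in M.
           limsup (\<lambda>n. ereal (sqrt (real n / ln (ln (real n))) *
                      (est n (\<lambda>i\<in>{..<n}. X i \<omega>) - \<theta>)))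
           = ereal (sqrt (2 * (m + 1) / (m * (2 * m - 1))))"
proof -
  interpret prob_space M by fact
  interpret pvii_sample M "\<lambda>i \<omega>. X i \<omega> - \<theta>" m
  proof unfold_locales
    show "indep_vars (\<lambda>_. borel) (\<lambda>i \<omega>. X i \<omega> - \<theta>) UNIV"
      by (rule indep_vars_compose2[OF indep]) auto
    show "distributed M lborel (\<lambda>\<omega>. X i \<omega> - \<theta>) (\<lambda>x. ennreal (pvii_density m x))" for i
      using distributed_affine[OF distr[of i], of 1 "- \<theta>"] by (simp add: divide_ennreal_def)
  qed (use m in simp)
  show ?thesis
  proof (rule limsup_minimizer_AE)
    fix n \<omega> t
    let ?x = "\<lambda>i\<in>{..<n}. X i \<omega>"
    let ?L = "\<lambda>t. \<Sum>i<n. ln (1 + (?x i - t)\<^sup>2)"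
    \<comment> \<open>The competitor is shifted by \<open>\<theta>\<close> because t is measured on
      the scale of the estimation error.\<close>
    have "pvii_lik m n ?x (\<theta> + t) \<le> pvii_lik m n ?x (est n ?x)"
      by (rule est_mle) (simp add: space_PiM)
    then have "?L (est n ?x) \<le> ?L (\<theta> + t)"
      using pvii_const_pos m by (simp add: pvii_lik_eq_exp)
    then show "(\<Sum>i<n. ln (1 + (X i \<omega> - \<theta> - (est n ?x - \<theta>))\<^sup>2)) \<le> (\<Sum>i<n. ln (1 + (X i \<omega> - \<theta> - t)\<^sup>2))"
      by (simp add: diff_diff_eq)
  qed
qed

end
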